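(* Let $0<\alpha<1$, $M>0$, $\varepsilon>0$, $S\in\mathbb{R}$, let $0=t_0<t_1<\dots<t_N=T$ be a (possibly non-uniform) temporal grid, and let $(\phi^n)_{0\le n\le N}$, $(r^{n+\frac12})_{-1\le n\le N-1}$, with $r^{\frac12}=r^{-\frac12}=(\phi^0)^2-1-S$, solve the $L1^+$-CN linear relaxation scheme for the volume-conserved time-fractional Allen-Cahn equation, that is, for all $0\le n\le N-1$, $$\partial_\tau^\alpha\phi^{n+\frac12}=-M\left(\mu^{n+\frac12}-\bar\mu^{n+\frac12}\right),$$ $$\mu^{n+\frac12}=-\varepsilon^2\Delta\phi^{n+\frac12}+\left(r^{n+\frac12}+S\right)\phi^{n+\frac12},$$ $$\frac{r^{n+\frac12}+r^{n-\frac12}}{2}=(\phi^n)^2-1-S,$$ $$\bar\mu^{n+\frac12}=|\Omega|^{-1}\langle\mu^{n+\frac12},1\rangle .$$ Define $$E[\phi]=\int_\Omega\frac{\varepsilon^2}{2}|\nabla\phi|^2+\frac14(\phi^2-1)^2\,d\mathbf{x},$$ $$\tilde E\left[\phi^{n+1},r^{n+\frac12}\right]=\int_\Omega\left(\frac{\varepsilon^2}{2}|\nabla\phi^{n+1}|^2+\frac12\left(r^{n+\frac12}+S\right)\left((\phi^{n+1})^2-1-S\right)-\frac14\left(r^{n+\frac12}\right)^2\right)d\mathbf{x}+\frac{S^2}{4}|\Omega| ,$$ with $\tilde E[\phi^0,r^{-\frac12}]$ given by the same formula with $n=-1$. (i) For all $0\le n\le N-1$, $$\tilde E\left[\phi^{n+1},r^{n+\frac12}\right]\le\tilde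 E\left[\phi^0,r^{-\frac12}\right]=E[\phi^0].$$ (ii) Suppose moreover that the adjacent step ratios satisfy $\rho_{k+1}\ge H_{1-\alpha}(\rho_k)$ for all $k\ge2$ (with $k+1\le N$). Let $$\tilde E_\alpha\left[\phi^{n+1},r^{n+\frac12}\right]:=\tilde E\left[\phi^{n+1},r^{n+\frac12}\right]+\frac1M\mathcal A_{1-\alpha}\left(\nabla_\tau\phi^{n+1}\right).$$ Then for all $2\le n\le N-1$, $$\tilde E_\alpha\left[\phi^{n+1},r^{n+\frac12}\right]-\tilde E_\alpha\left[\phi^{n},r^{n-\frac12}\right]=-\frac1M\mathcal R_{1-\alpha}\left(\nabla_\tau\phi^{n+1}\right)\le0 .$$
   Context: $\Omega$ is a bounded rectangular spatial domain with periodic boundary conditions; all functions $\phi^n,r^{n+\frac12},\mu^{n+\frac12}$ are real-valued, periodic and sufficiently smooth in space (the scheme is discrete in time only). $\langle\cdot,\cdot\rangle$ and $\|\cdot\|$ are the $L^2(\Omega)$ inner product and norm, and $|\Omega|$ is the measure of $\Omega$. Time steps: $\tau_k=t_k-t_{k-1}$ for $1\le k\le N$, adjacent step ratios $\rho_k=\tau_k/\tau_{k-1}$ for $2\le k\le N$. Notation: $\nabla_\tau u^k=u^k-u^{k-1}$ and $\phi^{n+\frac12}=\frac{\phi^{n+1}+\phi^n}{2}$. In contrast, $r^{n+\frac12}$ and $\mu^{n+\frac12}$ are unknowns attached to the half-level $n+\frac12$ (they are not averages). For $\beta\in(0,1)$ let $\omega_\beta(t)=t^{\beta-1}/\Gamma(\beta)$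 and, for $1\le k\le n$, $$b^{(\beta,n)}_{n-k}=\frac{1}{\tau_n\tau_k}\int_{t_{n-1}}^{t_n}\int_{t_{k-1}}^{\min\{t_k,t\}}\omega_\beta(t-s)\,ds\,dt .$$ The $L1^+$ approximation of the Caputo derivative of order $\alpha$ is $\partial_\tau^\alpha\phi^{n+\frac12}=\sum_{k=1}^{n+1}b^{(1-\alpha,n+1)}_{n+1-k}\nabla_\tau\phi^k$. Modified kernels: $\tilde b^{(\beta,n)}_0=2b^{(\beta,n)}_0$ and $\tilde b^{(\beta,n)}_j=b^{(\beta,n)}_j$ for $1\le j\le n-1$. Step-ratio function: with $h_\beta(s)=(1+s)^{1+\beta}-s^{1+\beta}-1$, $$H_\beta(\rho)=\left[\frac{2h_\beta(\rho)-h_\beta(2\rho)}{\rho^{\beta}\,(4-2^{1+\beta})}\right]^{1/\beta}.$$ For a sequence $u^1,u^2,\dots$ of functions in $L^2(\Omega)$, define $$\mathcal A_\beta(u^n)=\frac12\sum_{k=1}^{n-1}\left(\tilde b^{(\beta,n)}_{n-k-1}-\tilde b^{(\beta,n)}_{n-k}\right)\Big\|\sum_{j=k+1}^n u^j\Big\|^2+\frac12\tilde b^{(\beta,n)}_{n-1}\Big\|\sum_{j=1}^n u^j\Big\|^2\quad(n\ge1),$$ $$\mathcal R_\beta(u^n)=\frac12\sum_{k=1}^{n-2}\left(\tilde b^{(\beta,n-1)}_{n-2-k}-\tilde b^{(\beta,n-1)}_{n-1-k}-\tilde b^{(\beta,n)}_{n-1-k}+\tilde b^{(\beta,n)}_{n-k}\right)\Big\|\sum_{j=k+1}^{n-1}u^j\Big\|^2+\frac12\left(\tilde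 b^{(\beta,n-1)}_{n-2}-\tilde b^{(\beta,n)}_{n-1}\right)\Big\|\sum_{j=1}^{n-1}u^j\Big\|^2\quad(n\ge2).$$ $\mathcal A_{1-\alpha}(\nabla_\tau\phi^{n+1})$ and $\mathcal R_{1-\alpha}(\nabla_\tau\phi^{n+1})$ denote these functionals with $\beta=1-\alpha$, index $n+1$ in place of $n$, and $u^j=\nabla_\tau\phi^j$. *)

theory Defs
  imports "HOL-Analysis.Analysis"
begin

text \<open>The domain is \<open>\<Omega> = box a b\<close>.  A function on \<open>\<Omega>\<close> with periodic boundary conditions is a
  function on the whole space that has period \<open>b\<^sub>i - a\<^sub>i\<close> in each coordinate direction.\<close>

definition box_periodic :: "'a::euclidean_space \<Rightarrow> 'a \<Rightarrow> ('a \<Rightarrow> real) \<Rightarrow> bool" where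
  "box_periodic a b f \<longleftrightarrow> (\<forall>x. \<forall>i\<in>Basis. f (x + ((b - a) \<bullet> i) *\<^sub>R i) = f x)"

definition partial_deriv :: "'a::euclidean_space \<Rightarrow> ('a \<Rightarrow> real) \<Rightarrow> 'a \<Rightarrow> real" where
  "partial_deriv i f x = frechet_derivative f (at x) i"

primrec C_diff :: "nat \<Rightarrow> ('a::euclidean_space \<Rightarrow> real) \<Rightarrow> bool" where
  "C_diff 0 f \<longleftrightarrow> continuous_on UNIV f"
| "C_diff (Suc k) f \<longleftrightarrow>
     (\<forall>x. f differentiable (at x)) \<and> (\<forall>i\<in>Basis. C_diff k (partial_deriv i f))"

definition grad :: "('a::euclidean_space \<Rightarrow> real) \<Rightarrow> 'a \<Rightarrow> 'a" where
  "grad f x = (\<Sum>i\<in>Basis. partial_deriv i f x *\<^sub>R i)"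

definition laplacian :: "('a::euclidean_space \<Rightarrow> real) \<Rightarrow> 'a \<Rightarrow> real" where
  "laplacian f x = (\<Sum>i\<in>Basis. partial_deriv i (partial_deriv i f) x)"

definition L2_inner :: "'a::euclidean_space set \<Rightarrow> ('a \<Rightarrow> real) \<Rightarrow> ('a \<Rightarrow> real) \<Rightarrow> real" where
  "L2_inner \<Omega> f g = (LINT x:\<Omega>|lborel. f x * g x)"

definition L2_norm :: "'a::euclidean_space set \<Rightarrow> ('a \<Rightarrow> real) \<Rightarrow> real" where
  "L2_norm \<Omega> f = sqrt (L2_inner \<Omega> f f)"

definition mean_value :: "'a::euclidean_space set \<Rightarrow> ('a \<Rightarrow> real) \<Rightarrow> real" where
  "mean_value \<Omega> f = L2_inner \<Omega> f (\<lambda>_. 1) / measure lborel \<Omega>"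

definition time_step :: "(nat \<Rightarrow> real) \<Rightarrow> nat \<Rightarrow> real" where
  "time_step t k = t k - t (k - 1)"

definition step_ratio :: "(nat \<Rightarrow> real) \<Rightarrow> nat \<Rightarrow> real" where
  "step_ratio t k = time_step t k / time_step t (k - 1)"

definition backward_diff :: "(nat \<Rightarrow> 'a \<Rightarrow> real) \<Rightarrow> nat \<Rightarrow> 'a \<Rightarrow> real" where
  "backward_diff u k = (\<lambda>x. u k x - u (k - 1) x)"

definition avg_half :: "(nat \<Rightarrow> 'a \<Rightarrow> real) \<Rightarrow> nat \<Rightarrow> 'a \<Rightarrow> real" where
  "avg_half u n = (\<lambda>x. (u (n + 1) x + u n x) / 2)"

definition omega :: "real \<Rightarrow> real \<Rightarrow> real" where
  "omega \<beta> s = s powr (\<beta> - 1) / Gamma \<beta>"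

text \<open>\<open>kernel_b t \<beta> n j\<close> is \<open>b\<^sub>j\<close> of superscript \<open>(\<beta>, n)\<close>, for \<open>0 \<le> j < n\<close>; it belongs to the
  time interval number \<open>k = n - j\<close>.\<close>

definition kernel_b :: "(nat \<Rightarrow> real) \<Rightarrow> real \<Rightarrow> nat \<Rightarrow> nat \<Rightarrow> real" where
  "kernel_b t \<beta> n j =
     (let k = n - j in
      1 / (time_step t n * time_step t k) *
      (LBINT v=t (n - 1)..t n. (LBINT s=t (k - 1)..min (t k) v. omega \<beta> (v - s))))"

definition kernel_b_mod :: "(nat \<Rightarrow> real) \<Rightarrow> real \<Rightarrow> nat \<Rightarrow> nat \<Rightarrow> real" where
  "kernel_b_mod t \<beta> n j = (if j = 0 then 2 * kernel_b t \<beta> n 0 else kernel_b t \<beta> n j)"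

definition caputo_L1plus :: "(nat \<Rightarrow> real) \<Rightarrow> real \<Rightarrow> (nat \<Rightarrow> 'a \<Rightarrow> real) \<Rightarrow> nat \<Rightarrow> 'a \<Rightarrow> real" where
  "caputo_L1plus t \<alpha> \<phi> n x =
     (\<Sum>k=1..n+1. kernel_b t (1 - \<alpha>) (n + 1) (n + 1 - k) * backward_diff \<phi> k x)"

definition h_fun :: "real \<Rightarrow> real \<Rightarrow> real" where
  "h_fun \<beta> s = (1 + s) powr (1 + \<beta>) - s powr (1 + \<beta>) - 1"

definition H_fun :: "real \<Rightarrow> real \<Rightarrow> real" where
  "H_fun \<beta> \<rho> =
     ((2 * h_fun \<beta> \<rho> - h_fun \<beta> (2 * \<rho>)) / (\<rho> powr \<beta> * (4 - 2 powr (1 + \<beta>)))) powr (1 / \<beta>)"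

definition A_fun ::
  "'a::euclidean_space set \<Rightarrow> (nat \<Rightarrow> real) \<Rightarrow> real \<Rightarrow> (nat \<Rightarrow> 'a \<Rightarrow> real) \<Rightarrow> nat \<Rightarrow> real" where
  "A_fun \<Omega> t \<beta> u n =
     1/2 * (\<Sum>k=1..n-1. (kernel_b_mod t \<beta> n (n - k - 1) - kernel_b_mod t \<beta> n (n - k)) *
              (L2_norm \<Omega> (\<lambda>x. \<Sum>j=k+1..n. u j x))\<^sup>2)
     + 1/2 * kernel_b_mod t \<beta> n (n - 1) * (L2_norm \<Omega> (\<lambda>x. \<Sum>j=1..n. u j x))\<^sup>2"

definition R_fun ::
  "'a::euclidean_space set \<Rightarrow> (nat \<Rightarrow> real) \<Rightarrow> real \<Rightarrow> (nat \<Rightarrow> 'a \<Rightarrow> real) \<Rightarrow> nat \<Rightarrow> real" where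
  "R_fun \<Omega> t \<beta> u n =
     1/2 * (\<Sum>k=1..n-2. (kernel_b_mod t \<beta> (n - 1) (n - 2 - k) - kernel_b_mod t \<beta> (n - 1) (n - 1 - k)
                          - kernel_b_mod t \<beta> n (n - 1 - k) + kernel_b_mod t \<beta> n (n - k)) *
              (L2_norm \<Omega> (\<lambda>x. \<Sum>j=k+1..n-1. u j x))\<^sup>2)
     + 1/2 * (kernel_b_mod t \<beta> (n - 1) (n - 2) - kernel_b_mod t \<beta> n (n - 1)) *
         (L2_norm \<Omega> (\<lambda>x. \<Sum>j=1..n-1. u j x))\<^sup>2"

definition energy :: "'a::euclidean_space set \<Rightarrow> real \<Rightarrow> ('a \<Rightarrow> real) \<Rightarrow> real" where
  "energy \<Omega> \<epsilon> \<phi> =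
     (LINT x:\<Omega>|lborel. \<epsilon>\<^sup>2 / 2 * (norm (grad \<phi> x))\<^sup>2 + 1/4 * ((\<phi> x)\<^sup>2 - 1)\<^sup>2)"

definition relaxed_energy ::
  "'a::euclidean_space set \<Rightarrow> real \<Rightarrow> real \<Rightarrow> ('a \<Rightarrow> real) \<Rightarrow> ('a \<Rightarrow> real) \<Rightarrow> real" where
  "relaxed_energy \<Omega> \<epsilon> S \<phi> r =
     (LINT x:\<Omega>|lborel. \<epsilon>\<^sup>2 / 2 * (norm (grad \<phi> x))\<^sup>2
        + 1/2 * (r x + S) * ((\<phi> x)\<^sup>2 - 1 - S) - 1/4 * (r x)\<^sup>2)
     + S\<^sup>2 / 4 * measure lborel \<Omega>"

text \<open>Index conventions for the half levels: \<open>\<mu> n\<close> is the potential at level \<open>n + 1/2\<close>, but \<open>r n\<close>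
  is the relaxation variable at level \<open>n - 1/2\<close>, so that \<open>r 0\<close> lives at level \<open>- 1/2\<close> and
  the energy at step \<open>n\<close> pairs \<open>\<phi> n\<close> with \<open>r n\<close>.  Of the spatial smoothness we require what the
  scheme needs classically: \<open>\<phi> n\<close> twice continuously differentiable, \<open>r n\<close> and \<open>\<mu> n\<close>
  continuous.\<close>

definition L1plus_CN_relaxation ::
  "'a::euclidean_space \<Rightarrow> 'a \<Rightarrow> real \<Rightarrow> real \<Rightarrow> real \<Rightarrow> real \<Rightarrow> (nat \<Rightarrow> real) \<Rightarrow> nat \<Rightarrow>
   (nat \<Rightarrow> 'a \<Rightarrow> real) \<Rightarrow> (nat \<Rightarrow> 'a \<Rightarrow> real) \<Rightarrow> (nat \<Rightarrow> 'a \<Rightarrow> real) \<Rightarrow> bool" where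
  "L1plus_CN_relaxation a b \<alpha> M \<epsilon> S t N \<phi> r \<mu> \<longleftrightarrow>
     (\<forall>n\<le>N. box_periodic a b (\<phi> n) \<and> C_diff 2 (\<phi> n)) \<and>
     (\<forall>n\<le>N. box_periodic a b (r n) \<and> C_diff 0 (r n)) \<and>
     (\<forall>n<N. box_periodic a b (\<mu> n) \<and> C_diff 0 (\<mu> n)) \<and>
     (\<forall>x\<in>box a b. r 0 x = (\<phi> 0 x)\<^sup>2 - 1 - S \<and> r 1 x = (\<phi> 0 x)\<^sup>2 - 1 - S) \<and>
     (\<forall>n<N. \<forall>x\<in>box a b.
        caputo_L1plus t \<alpha> \<phi> n x = - M * (\<mu> n x - mean_value (box a b) (\<mu> n)) \<and>
        \<mu> n x = - \<epsilon>\<^sup>2 * laplacian (avg_half \<phi> n) x + (r (n + 1) x + S) * avg_half \<phi> n x \<and>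
        (r (n + 1) x + r n x) / 2 = (\<phi> n x)\<^sup>2 - 1 - S)"

definition modified_energy ::
  "'a::euclidean_space set \<Rightarrow> real \<Rightarrow> real \<Rightarrow> real \<Rightarrow> real \<Rightarrow> (nat \<Rightarrow> real) \<Rightarrow>
   (nat \<Rightarrow> 'a \<Rightarrow> real) \<Rightarrow> (nat \<Rightarrow> 'a \<Rightarrow> real) \<Rightarrow> nat \<Rightarrow> real" where
  "modified_energy \<Omega> \<alpha> M \<epsilon> S t \<phi> r n =
     relaxed_energy \<Omega> \<epsilon> S (\<phi> n) (r n) + 1 / M * A_fun \<Omega> t (1 - \<alpha>) (backward_diff \<phi>) n"

end

theory Submission
  imports Defs
begin

text \<open>Testing the scheme with \<open>\<phi>\<^sup>n\<^sup>+\<^sup>1 - \<phi>\<^sup>n\<close> turns the increment of the relaxed energy into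
  \<open>- 1/M\<close> times the pairing of the discrete Caputo derivative with \<open>\<phi>\<^sup>n\<^sup>+\<^sup>1 - \<phi>\<^sup>n\<close>: Green's
  formula for periodic functions handles the Laplacian, the relaxation variable is designed so that its quadratic terms cancel, and the
  multiplier \<open>\<mu>\<close>-bar drops out because mass is conserved.

  With \<open>p = 1 + \<beta>\<close> the modified kernel is, up to a positive constant, the second difference of
  \<open>\<bar>t\<^sub>i - t\<^sub>j\<bar>\<^sup>p\<close> divided by the two step sizes.  Since \<open>- \<bar>s - t\<bar>\<^sup>p\<close> is conditionally positive
  definite for \<open>p < 2\<close>, the summed pairings are nonnegative, which gives (i).  Summation by parts
  writes each pairing as an increment of \<open>\<A>\<close> plus \<open>\<R>\<close>.  The coefficients of \<open>\<R>\<close> are mixed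
  second differences of the kernel; away from the diagonal their sign follows from convexity of the
  power function, and next to the diagonal, where the doubled entry enters, it is an inequality
  between three consecutive steps, implied by the step-ratio condition.\<close>

section \<open>Power inequalities\<close>

text \<open>Each increment is paired with its whole history, and a single pairing, as a form in
  arbitrary increments, can be negative; so (i) sums over all steps and compares only with the
  start. The doubling of \<open>b_0\<close> fits both parts: the pairing is lower triangular, so
  symmetrising doubles the diagonal relative to the rest, and the diagonal integral runs over a
  triangle, half of what the second difference gives. The function \<open>H_fun\<close> comes from
  the sign of one coefficient. For consecutive steps \<open>x, y, z\<close> with
  \<open>z <= y\<close>, concavity leaves a quantity in \<open>x\<close> and \<open>y\<close> alone,
  \<open>x^p\<close> times \<open>2 h(y/x) - h(2 y/x)\<close>, and \<open>4 - 2^p\<close> is the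
  constant for which the remaining scalar inequality is an equality at \<open>z = y\<close>. Mass
  conservation is not assumed: the scheme makes the Caputo derivative mean free, and a triangular
  system with positive diagonal does the rest. Since \<open>u^p\<close> is not twice differentiable
  at 0, a base point that does occur, convexity is used through chord slopes, with derivatives taken
  only in the open interval.\<close>

lemma slope_mono:
  fixes f f' :: "real \<Rightarrow> real"
  assumes "a < b" "b < c" and cont: "continuous_on {a..c} f"
    and der: "\<And>x. a < x \<Longrightarrow> x < c \<Longrightarrow> (f has_real_derivative f' x) (at x)"
    and mono: "\<And>x y. a < x \<Longrightarrow> x \<le> y \<Longrightarrow> y < c \<Longrightarrow> f' x \<le> f' y"
  shows "(f b - f a) / (b - a) \<le> (f c - f b) / (c - b)"
proof -
  have "\<exists>l z. a < z \<and> z < b \<and> DERIV f z :> l \<and> f b - f a = (b - a) * l"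
    using assms by (intro MVT) (force intro: continuous_on_subset simp: real_differentiable_def)+
  then obtain l z where z: "a < z" "z < b" "DERIV f z :> l" "f b - f a = (b - a) * l" by blast
  have "\<exists>l z. b < z \<and> z < c \<and> DERIV f z :> l \<and> f c - f b = (c - b) * l"
    using assms by (intro MVT) (force intro: continuous_on_subset simp: real_differentiable_def)+
  then obtain m w where w: "b < w" "w < c" "DERIV f w :> m" "f c - f b = (c - b) * m" by blast
  have "l = f' z" "m = f' w"
    using z w assms(1,2) by (auto intro!: DERIV_unique der)
  then have "l \<le> m" using mono[of z w] z w by simp
  then show ?thesis using z w assms(1,2) by simp
qed

text \<open>The chord slope over the whole interval is a weighted mean of the two adjacent ones,
  hence at least the left one.\<close>

lemma slope_mono_left:
  fixes f f' :: "real \<Rightarrow> real"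
  assumes "a < b" "b \<le> c" and cont: "continuous_on {a..c} f"
    and der: "\<And>x. a < x \<Longrightarrow> x < c \<Longrightarrow> (f has_real_derivative f' x) (at x)"
    and mono: "\<And>x y. a < x \<Longrightarrow> x \<le> y \<Longrightarrow> y < c \<Longrightarrow> f' x \<le> f' y"
  shows "(f b - f a) / (b - a) \<le> (f c - f a) / (c - a)"
proof (cases "b = c")
  case False
  have "(f b - f a) / (b - a) \<le> (f c - f b) / (c - b)"
    using assms False by (intro slope_mono[of a b c f f']) auto
  then have "(f b - f a) * (c - b) \<le> (f c - f b) * (b - a)"
    using assms(1,2) False by (simp add: field_simps)
  then show ?thesis using assms(1,2) by (simp add: field_simps)
qed simp

text \<open>Convexity of a power with nonpositive exponent. It is used at
  \<open>\<beta> - 1\<close>, which is reached from \<open>1 + \<beta>\<close> after two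
  differentiations.\<close>

lemma powr_slope_mono_nonpos:
  fixes c x y u :: real
  assumes "c \<le> 0" "0 < u" "0 < x" "0 < y"
  shows "((u + y) powr c - u powr c) / y \<le> ((u + x + y) powr c - (u + y) powr c) / x"
proof -
  have "((u + y) powr c - u powr c) / (u + y - u) \<le>
      ((u + x + y) powr c - (u + y) powr c) / (u + x + y - (u + y))"
  proof (rule slope_mono[where f' = "\<lambda>x. c * x powr (c - 1)"])
    show "c * v powr (c - 1) \<le> c * w powr (c - 1)" if "u < v" "v \<le> w" for v w
      using assms that by (intro mult_left_mono_neg powr_mono2') auto
  qed (use assms in \<open>auto intro!: continuous_intros derivative_eq_intros\<close>)
  then show ?thesis by simp
qed

text \<open>Two adjacent chord slopes of the power subtracted, over a piece of length
  \<open>y\<close> followed by one of length \<open>x\<close>, as a function of the base point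
  \<open>u\<close>. Later \<open>y\<close> and \<open>x\<close> are neighbouring time steps, the
  more recent one first, and \<open>u\<close> is the distance to a later time level.\<close>

definition powr_slope_diff :: "real \<Rightarrow> real \<Rightarrow> real \<Rightarrow> real \<Rightarrow> real" where
  "powr_slope_diff p x y u =
     ((u + x + y) powr p - (u + y) powr p) / x - ((u + y) powr p - u powr p) / y"

lemma DERIV_powr_slope_diff:
  assumes "0 < u" "0 < x" "0 < y"
  shows "(powr_slope_diff p x y has_real_derivative p * powr_slope_diff (p - 1) x y u) (at u)"
  unfolding powr_slope_diff_def using assms
  by (auto intro!: derivative_eq_intros simp: field_simps)

text \<open>The derivative in \<open>u\<close> is \<open>\<beta>\<close> times the same expression
  with exponent \<open>\<beta> - 1\<close>, nonnegative by convexity of that power.\<close>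

lemma powr_slope_diff_mono:
  assumes "0 < \<beta>" "\<beta> < 1" "0 < x" "0 < y" "0 < u" "u \<le> v"
  shows "powr_slope_diff \<beta> x y u \<le> powr_slope_diff \<beta> x y v"
proof (rule DERIV_nonneg_imp_nondecreasing[OF assms(6)])
  fix w assume w: "u \<le> w" "w \<le> v"
  have "0 \<le> \<beta> * powr_slope_diff (\<beta> - 1) x y w"
    unfolding powr_slope_diff_def
    using powr_slope_mono_nonpos[of "\<beta> - 1" w x y] assms w by simp
  then show "\<exists>D. (powr_slope_diff \<beta> x y has_real_derivative D) (at w) \<and> 0 \<le> D"
    using DERIV_powr_slope_diff[of w x y \<beta>] assms w by (intro exI) auto
qed

lemma continuous_on_powr_slope_diff:
  assumes "0 < p" "0 \<le> u" "0 < x" "0 < y"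
  shows "continuous_on {u..v} (powr_slope_diff p x y)"
  unfolding powr_slope_diff_def using assms
  by (auto intro!: continuous_intros continuous_on_powr')

text \<open>Convexity in \<open>u\<close>: the derivative is a positive multiple of the version with
  exponent \<open>\<beta>\<close>, which is nondecreasing. The value \<open>u = 0\<close> is
  included because it occurs when two time levels coincide.\<close>

lemma powr_slope_diff_slope_mono:
  assumes "0 < \<beta>" "\<beta> < 1" "0 < x" "0 < y" "0 \<le> u" "u < v" "v < w"
  shows "(powr_slope_diff (1 + \<beta>) x y v - powr_slope_diff (1 + \<beta>) x y u) / (v - u)
       \<le> (powr_slope_diff (1 + \<beta>) x y w - powr_slope_diff (1 + \<beta>) x y v) / (w - v)"
proof (rule slope_mono)
  fix z assume z: "u < z"
  show "(powr_slope_diff (1 + \<beta>) x y has_real_derivative (1 + \<beta>) * powr_slope_diff \<beta> x y z) (at z)"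
    using DERIV_powr_slope_diff[of z x y "1 + \<beta>"] assms z by simp
  show "(1 + \<beta>) * powr_slope_diff \<beta> x y z \<le> (1 + \<beta>) * powr_slope_diff \<beta> x y z'" if "z \<le> z'" for z'
    using assms z that by (intro mult_left_mono powr_slope_diff_mono) auto
qed (use assms in \<open>auto intro!: continuous_on_powr_slope_diff\<close>)

lemma powr_slope_diff_slope_mono_left:
  assumes "0 < \<beta>" "\<beta> < 1" "0 < x" "0 < y" "0 \<le> u" "u < v" "v \<le> w"
  shows "(powr_slope_diff (1 + \<beta>) x y v - powr_slope_diff (1 + \<beta>) x y u) / (v - u)
       \<le> (powr_slope_diff (1 + \<beta>) x y w - powr_slope_diff (1 + \<beta>) x y u) / (w - u)"
proof (rule slope_mono_left)
  fix z assume z: "u < z"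
  show "(powr_slope_diff (1 + \<beta>) x y has_real_derivative (1 + \<beta>) * powr_slope_diff \<beta> x y z) (at z)"
    using DERIV_powr_slope_diff[of z x y "1 + \<beta>"] assms z by simp
  show "(1 + \<beta>) * powr_slope_diff \<beta> x y z \<le> (1 + \<beta>) * powr_slope_diff \<beta> x y z'" if "z \<le> z'" for z'
    using assms z that by (intro mult_left_mono powr_slope_diff_mono) auto
qed (use assms in \<open>auto intro!: continuous_on_powr_slope_diff\<close>)

text \<open>Concavity of \<open>v -> (v + x)^p - v^p\<close> with \<open>p = 1 + \<beta>\<close>:
  its derivative \<open>p ((v + x)^\<beta> - v^\<beta>)\<close> is nonincreasing because
  \<open>s^(\<beta> - 1)\<close> is.\<close>

lemma powr_increment_slope_antimono:
  fixes \<beta> x u v w :: real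
  assumes "0 < \<beta>" "\<beta> < 1" "0 < x" "0 \<le> u" "u < v" "v < w"
  shows "((w + x) powr (1 + \<beta>) - w powr (1 + \<beta>) - ((v + x) powr (1 + \<beta>) - v powr (1 + \<beta>))) / (w - v)
       \<le> ((v + x) powr (1 + \<beta>) - v powr (1 + \<beta>) - ((u + x) powr (1 + \<beta>) - u powr (1 + \<beta>))) / (v - u)"
proof -
  \<comment> \<open>The sign is reversed so that the chord lemma for convex functions
    applies.\<close>
  define f where "f = (\<lambda>z. z powr (1 + \<beta>) - (z + x) powr (1 + \<beta>))"
  define f' where "f' = (\<lambda>z. (1 + \<beta>) * (z powr \<beta> - (z + x) powr \<beta>))"
  have mono: "f' z \<le> f' z'" if z: "u < z" "z \<le> z'" for z z'
  proof (rule DERIV_nonneg_imp_nondecreasing[OF z(2)])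
    fix s assume s: "z \<le> s"
    have "(s + x) powr (\<beta> - 1) \<le> s powr (\<beta> - 1)"
      using assms s z by (intro powr_mono2') auto
    moreover have "(f' has_real_derivative (1 + \<beta>) * (\<beta> * (s powr (\<beta> - 1) - (s + x) powr (\<beta> - 1)))) (at s)"
      unfolding f'_def using assms s z by (auto intro!: derivative_eq_intros simp: algebra_simps)
    ultimately show "\<exists>D. (f' has_real_derivative D) (at s) \<and> 0 \<le> D"
      using assms
      by (intro exI[of _ "(1 + \<beta>) * (\<beta> * (s powr (\<beta> - 1) - (s + x) powr (\<beta> - 1)))"]) auto
  qed
  have "(f v - f u) / (v - u) \<le> (f w - f v) / (w - v)"
  proof (rule slope_mono[where f' = f'])
    show "continuous_on {u..w} f"
      unfolding f_def using assms by (auto intro!: continuous_intros continuous_on_powr')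
    show "(f has_real_derivative f' z) (at z)" if "u < z" for z
      unfolding f_def f'_def using assms that by (auto intro!: derivative_eq_intros simp: algebra_simps)
  qed (use assms mono in auto)
  then have "- ((f w - f v) / (w - v)) \<le> - ((f v - f u) / (v - u))" by simp
  then show ?thesis unfolding f_def by (simp add: minus_divide_left algebra_simps)
qed

section \<open>Scalar inequalities for three consecutive steps\<close>

text \<open>Divided by \<open>s^p\<close> this says \<open>r s >= r 1 = 3 - 2^p\<close>, so it is an
  equality at \<open>s = 1\<close> and follows once \<open>r\<close> is nonincreasing.\<close>

lemma one_plus_powr_le_on_unit:
  fixes p s :: real
  assumes p: "1 < p" "p < 2" and s: "0 < s" "s \<le> 1"
  shows "(1 + s) powr p + (3 - 2 powr p) * s powr p \<le> 1 + 2 * s"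
proof -
  define r where "r = (\<lambda>s. (1 + 2 * s - (1 + s) powr p) * s powr (- p))"
  have "r 1 \<le> r s"
  proof (rule DERIV_nonpos_imp_nonincreasing[OF s(2)])
    fix v assume v: "s \<le> v"
    have v0: "v > 0" using s v by simp
    define D where "D = (2 - p * (1 + v) powr (p - 1)) * v powr (- p)
        + (1 + 2 * v - (1 + v) powr p) * (- p * v powr (- p - 1))"
    have D: "(r has_real_derivative D) (at v)"
      unfolding r_def D_def using v0 by (auto intro!: derivative_eq_intros)
    have split: "(1 + v) powr p = (1 + v) * (1 + v) powr (p - 1)" "v powr (- p) = v * v powr (- p - 1)"
      using v0 by (simp_all add: powr_diff powr_minus)
    have "D = (2 * v * (1 - p) - p + p * (1 + v) powr (p - 1)) * v powr (- p - 1)"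
      unfolding D_def split by (simp add: algebra_simps)
    \<comment> \<open>Weighted arithmetic-geometric mean with weights \<open>p - 1\<close> and
      \<open>2 - p\<close>: Bernoulli's inequality for an exponent below 1.\<close>
    moreover have "(1 + v) powr (p - 1) \<le> 1 + (p - 1) * v"
      using Youngs_inequality_0[of "p - 1" "2 - p" "1 + v" 1] p v0 by (simp add: algebra_simps)
    then have "p * (1 + v) powr (p - 1) \<le> p * (1 + (p - 1) * v)"
      using p by (intro mult_left_mono) auto
    then have "2 * v * (1 - p) - p + p * (1 + v) powr (p - 1) \<le> (p - 1) * (p - 2) * v"
      by (simp add: algebra_simps)
    moreover have "(p - 1) * (p - 2) * v \<le> 0"
      using p v0 by (intro mult_nonpos_nonneg mult_nonneg_nonpos) auto
    ultimately have "D \<le> 0" by (simp add: mult_nonpos_nonneg)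
    then show "\<exists>y. (r has_real_derivative y) (at v) \<and> y \<le> 0" using D by blast
  qed
  then have "3 - 2 powr p \<le> (1 + 2 * s - (1 + s) powr p) * s powr (- p)"
    by (simp add: r_def)
  then have "(3 - 2 powr p) * s powr p \<le> (1 + 2 * s - (1 + s) powr p) * s powr (- p) * s powr p"
    by (intro mult_right_mono) auto
  also have "\<dots> = 1 + 2 * s - (1 + s) powr p"
    using s by (simp add: powr_minus)
  finally show ?thesis by simp
qed

text \<open>The case of equal last two steps, both normalised to 1. The two sides vanish at
  \<open>x = 0\<close>, so it suffices to compare derivatives.\<close>

lemma uniform_step_bound:
  fixes \<beta> x :: real
  assumes b: "0 < \<beta>" "\<beta> < 1" and x: "0 < x"
  shows "2 * (1 + x) powr (1 + \<beta>) - 2 - (2 + x) powr (1 + \<beta>) + 2 powr (1 + \<beta>) - x powr (1 + \<beta>)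
       \<le> (4 - 2 powr (1 + \<beta>)) * x"
proof -
  \<comment> \<open>Up to the factor \<open>1 + \<beta>\<close>, \<open>K'\<close> is the derivative
    of the left-hand side of the claim, not of \<open>K\<close>.\<close>
  define K' where "K' = (\<lambda>x::real. 2 * (1 + x) powr \<beta> - (2 + x) powr \<beta> - x powr \<beta>)"
  define K where "K = (\<lambda>x::real. (4 - 2 powr (1 + \<beta>)) * x -
     (2 * (1 + x) powr (1 + \<beta>) - 2 - (2 + x) powr (1 + \<beta>) + 2 powr (1 + \<beta>) - x powr (1 + \<beta>)))"
  have "K' u \<le> K' 0" if "0 < u" for u
  proof (rule DERIV_nonpos_imp_decreasing_open[of 0 u K'])
    fix v :: real assume v: "0 < v"
    have "powr_slope_diff (\<beta> - 1) 1 1 v \<ge> 0"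
      unfolding powr_slope_diff_def using powr_slope_mono_nonpos[of "\<beta> - 1" v 1 1] b v by simp
    then have "\<beta> * (2 * (1 + v) powr (\<beta> - 1) - (2 + v) powr (\<beta> - 1) - v powr (\<beta> - 1)) \<le> 0"
      using b by (intro mult_nonneg_nonpos) (auto simp: powr_slope_diff_def algebra_simps)
    moreover have "(K' has_real_derivative \<beta> * (2 * (1 + v) powr (\<beta> - 1) - (2 + v) powr (\<beta> - 1) - v powr (\<beta> - 1))) (at v)"
      unfolding K'_def using v by (auto intro!: derivative_eq_intros simp: algebra_simps)
    ultimately show "\<exists>y. (K' has_real_derivative y) (at v) \<and> y \<le> 0" by blast
  next
    show "continuous_on {0..u} K'"
      unfolding K'_def using b by (auto intro!: continuous_intros continuous_on_powr')
  qed (use that in auto)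
  moreover have "K' 0 = 2 - 2 powr \<beta>" using b by (simp add: K'_def)
  ultimately have K': "K' u \<le> 2 - 2 powr \<beta>" if "0 < u" for u using that by simp
  have two: "2 powr \<beta> < 2" using powr_less_mono[of \<beta> 1 2] b by simp
  have "K 0 \<le> K x"
  proof (rule DERIV_nonneg_imp_increasing_open[of 0 x K])
    fix v :: real assume v: "0 < v"
    \<comment> \<open>Since \<open>4 - 2^(1 + \<beta>) = 2 (2 - 2^\<beta>)\<close>, the bound on
      \<open>K'\<close> and \<open>1 + \<beta> < 2\<close> give the sign.\<close>
    have "(1 + \<beta>) * K' v \<le> 2 * (2 - 2 powr \<beta>)"
    proof -
      have "(1 + \<beta>) * K' v \<le> (1 + \<beta>) * (2 - 2 powr \<beta>)"
        using K'[OF v] b by (intro mult_left_mono) auto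
      also have "\<dots> \<le> 2 * (2 - 2 powr \<beta>)" using b two by (intro mult_right_mono) auto
      finally show ?thesis .
    qed
    then have "0 \<le> (4 - 2 powr (1 + \<beta>)) - (1 + \<beta>) * K' v" by (simp add: powr_add)
    moreover have "(K has_real_derivative (4 - 2 powr (1 + \<beta>)) - (1 + \<beta>) * K' v) (at v)"
      unfolding K_def K'_def using v by (auto intro!: derivative_eq_intros simp: algebra_simps)
    ultimately show "\<exists>y. (K has_real_derivative y) (at v) \<and> 0 \<le> y" by blast
  next
    show "continuous_on {0..x} K"
      unfolding K_def using b by (auto intro!: continuous_intros continuous_on_powr')
  qed (use x in auto)
  then show ?thesis using b by (simp add: K_def)
qed


lemma nonneg_of_mult_nonneg:
  fixes a b :: real
  shows "0 \<le> a * b \<Longrightarrow> 0 < a \<Longrightarrow> 0 \<le> b"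
  by (simp add: zero_le_mult_iff)

text \<open>The letters \<open>P, Q, R, U, V, W\<close> stand for the \<open>p\<close>-th powers of
  \<open>x + y\<close>, \<open>y\<close>, \<open>x\<close>, \<open>y + z\<close>, \<open>z\<close>,
  \<open>x + y + z\<close>; treated as atoms they leave a rational identity.\<close>

lemma mixed_diff_cleared:
  fixes x y z :: real assumes "x \<noteq> 0" "y \<noteq> 0" "z \<noteq> 0"
  shows "2 * x * (z / y) * Q - z * (P - Q - R) - x * (U - Q - V) + y * (W - U - P + Q)
   = x * y * z * (2 * Q / (y * y) - (P - Q - R) / (y * x) - (U - Q - V) / (z * y) + (W - U - P + Q) / (z * x))"
proof -
  have "2 * Q / (y * y) * (x * y * z) = 2 * x * (z / y) * Q" using assms by simp
  moreover have "(P - Q - R) / (y * x) * (x * y * z) = z * (P - Q - R)" using assms by simp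
  moreover have "(U - Q - V) / (z * y) * (x * y * z) = x * (U - Q - V)" using assms by simp
  moreover have "(W - U - P + Q) / (z * x) * (x * y * z) = y * (W - U - P + Q)" using assms by simp
  ultimately show ?thesis by algebra
qed
text \<open>Isolates the dependence on \<open>z\<close>: a difference quotient of
  \<open>powr_slope_diff\<close> between the base points 0 and \<open>z\<close>.\<close>

lemma mixed_diff_slope_form:
  fixes x y z :: real 
  shows "2 * Q / (y * y) - (P - Q - R) / (y * x) - (U - Q - V) / (z * y) + (W - U - P + Q) / (z * x)
   = 2 * Q / (y * y) - (P - Q - R) / (y * x) + (((W - U) / x - (U - V) / y) - ((P - Q) / x - Q / y)) / z"
  by (simp add: diff_divide_distrib add_divide_distrib mult.commute)
lemma uniform_diff_cleared:
  fixes x y z :: real assumes "x \<noteq> 0" "y \<noteq> 0"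
  shows "x * y * y * (2 * Q / (y * y) - (P - Q - R) / (y * x)
        + (((X - Y) / x - (Y - Q) / y) - ((P - Q) / x - Q / y)) / y)
      = 2 * x * Q - y * (P - Q - R) + y * (X - Y - P + Q) - x * (Y - 2 * Q)"
proof -
  have "2 * Q / (y * y) * (x * y * y) = 2 * x * Q" using assms by simp
  moreover have "(P - Q - R) / (y * x) * (x * y * y) = y * (P - Q - R)" using assms by simp
  moreover have "(((X - Y) / x - (Y - Q) / y) - ((P - Q) / x - Q / y)) / y * (x * y * y) = y * (X - Y - P + Q) - x * (Y - 2 * Q)"
    using assms by (simp add: field_simps)
  ultimately show ?thesis by algebra
qed


text \<open>For \<open>z \<le> y\<close> the increments of the concave function \<open>(v + x)\<^sup>p - v\<^sup>p\<close> over \<open>[y, y + z]\<close> are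
  compared with those over \<open>[y, 2 y]\<close>, which is where the step-ratio function comes from; the rest
  is the inequality \<open>(1 + s)\<^sup>p + (3 - 2\<^sup>p) s\<^sup>p \<le> 1 + 2 s\<close> with \<open>s = z / y\<close>.
  For \<open>z > y\<close> the step-ratio hypothesis is void: the expression is
  increasing in \<open>z\<close>, and at \<open>z = y\<close> it is nonnegative for every \<open>x\<close>.\<close>

lemma adjacent_kernel_bound:
  fixes \<beta> x y z :: real
  defines "p \<equiv> 1 + \<beta>"
  assumes b: "0 < \<beta>" "\<beta> < 1" and pos: "0 < x" "0 < y" "0 < z"
    and ratio: "H_fun \<beta> (y / x) \<le> z / y"
  shows "0 \<le> 2 * y powr p / (y * y) - ((x + y) powr p - y powr p - x powr p) / (y * x)
     - ((y + z) powr p - y powr p - z powr p) / (z * y)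
     + ((x + y + z) powr p - (y + z) powr p - (x + y) powr p + y powr p) / (z * x)"
    (is "0 \<le> ?F")
proof -
  define s where "s = z / y"
  define \<xi> where "\<xi> = x / y"
  have s: "0 < s" "z = s * y" and \<xi>: "0 < \<xi>" "x = \<xi> * y" using pos by (auto simp: s_def \<xi>_def)
  have Y2: "(2 * y) powr p = 2 powr p * y powr p" using pos by (simp add: powr_mult)
  have four: "0 < 4 - 2 powr p"
    using powr_less_mono[of p 2 2] b by (simp add: p_def)
  show ?thesis
  proof (cases "z \<le> y")
    case True
    \<comment> \<open>By the concavity bound \<open>conc\<close>, the two terms of the cleared
      inequality with factors \<open>z\<close> and \<open>y\<close> are together at least
      \<open>- z * C\<close>.\<close>
    define C where "C = 2 * (x + y) powr p - 2 * y powr p - x powr p - (x + 2 * y) powr p + (2 * y) powr p"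
    have conc: "z * ((x + 2 * y) powr p - (2 * y) powr p - ((x + y) powr p - y powr p))
        \<le> y * ((x + y + z) powr p - (y + z) powr p - ((x + y) powr p - y powr p))"
    proof (cases "z = y")
      case False
      with True have "z < y" by simp
      then show ?thesis
        using powr_increment_slope_antimono[of \<beta> x y "y + z" "2 * y"] b pos
        by (simp add: p_def field_simps)
    qed (simp add: algebra_simps)
    have "C \<le> (4 - 2 powr p) * (x * z powr \<beta>)"
    proof -
      \<comment> \<open>\<open>A\<close> is the numerator in \<open>H_fun\<close>, and
        \<open>C\<close> is its homogeneous form.\<close>
      define A where "A = 2 * h_fun \<beta> (y / x) - h_fun \<beta> (2 * (y / x))"
      have C: "C = A * x powr p"
      proof -
        have scale: "u powr p * x powr p = v powr p" if "u * x = v" for u v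
          using that powr_mult[of u x p] by simp
        have "(1 + y / x) powr p * x powr p = (x + y) powr p"
          "(1 + 2 * (y / x)) powr p * x powr p = (x + 2 * y) powr p"
          "(y / x) powr p * x powr p = y powr p"
          "(2 * (y / x)) powr p * x powr p = (2 * y) powr p"
          by (rule scale, use pos in \<open>simp add: field_simps\<close>)+
        then show ?thesis
          unfolding A_def C_def h_fun_def p_def[symmetric] by (simp add: algebra_simps)
      qed
      show ?thesis
      \<comment> \<open>The base of the outer power in \<open>H_fun\<close> has the sign of
        \<open>A\<close>, so the power can be undone only for positive \<open>A\<close>; otherwise
        the bound holds by sign alone.\<close>
      proof (cases "A \<le> 0")
        case True
        then have "C \<le> 0" unfolding C by (simp add: mult_nonpos_nonneg)
        also have "0 \<le> (4 - 2 powr p) * (x * z powr \<beta>)" using four pos by simp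
        finally show ?thesis .
      next
        case False
        define G where "G = A / ((y / x) powr \<beta> * (4 - 2 powr p))"
        have "0 \<le> G" unfolding G_def using False four pos by simp
        have "G powr (1 / \<beta>) \<le> z / y"
          using ratio unfolding H_fun_def A_def[symmetric] p_def[symmetric] G_def .
        then have "(G powr (1 / \<beta>)) powr \<beta> \<le> (z / y) powr \<beta>"
          using b by (intro powr_mono2) auto
        then have "G \<le> (z / y) powr \<beta>" using b \<open>0 \<le> G\<close> by (simp add: powr_powr)
        then have "A \<le> (z / y) powr \<beta> * ((y / x) powr \<beta> * (4 - 2 powr p))"
          unfolding G_def using four pos by (subst (asm) pos_divide_le_eq) auto
        \<comment> \<open>The middle step \<open>y\<close> cancels in the product of the two
          ratios.\<close>
        also have "\<dots> = (z / x) powr \<beta> * (4 - 2 powr p)"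
          using pos by (simp add: powr_divide)
        finally have "C \<le> (z / x) powr \<beta> * (4 - 2 powr p) * x powr p"
          unfolding C by (intro mult_right_mono) auto
        also have "\<dots> = (4 - 2 powr p) * (x * z powr \<beta>)"
          using pos by (simp add: powr_divide p_def powr_add)
        finally show ?thesis .
      qed
    qed
    then have "z * C \<le> z * ((4 - 2 powr p) * (x * z powr \<beta>))"
      using pos by (intro mult_left_mono) auto
    also have "\<dots> = x * ((4 - 2 powr p) * z powr p)"
      using pos by (simp add: p_def powr_add)
    finally have zC: "z * C \<le> x * ((4 - 2 powr p) * z powr p)" .
    \<comment> \<open>The coefficient \<open>3 - 2^p\<close> is \<open>4 - 2^p\<close> from the
      bound on \<open>z * C\<close>, minus 1 from the term \<open>x * z^p\<close>. What remains is
      the inequality on the unit interval at \<open>s = z / y\<close>, scaled by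
      \<open>x * y^p\<close>.\<close>
    have "x * y powr p * ((1 + s) powr p + (3 - 2 powr p) * s powr p) \<le> x * y powr p * (1 + 2 * s)"
    proof (intro mult_left_mono one_plus_powr_le_on_unit)
      show "s \<le> 1" using True pos by (simp add: s_def)
    qed (use b s(1) pos in \<open>auto simp: p_def\<close>)
    moreover have "(1 + s) powr p * y powr p = (y + z) powr p" "s powr p * y powr p = z powr p"
      using s pos by (auto simp flip: powr_mult simp: algebra_simps)
    moreover have "x * y powr p * ((1 + s) powr p + (3 - 2 powr p) * s powr p) =
        x * ((1 + s) powr p * y powr p + (3 - 2 powr p) * (s powr p * y powr p))" by algebra
    ultimately have "x * ((y + z) powr p + (3 - 2 powr p) * z powr p) \<le> x * y powr p * (1 + 2 * s)"
      by metis
    then have "0 \<le> 2 * x * s * y powr p - z * ((x + y) powr p - y powr p - x powr p)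
       - x * ((y + z) powr p - y powr p - z powr p)
       + y * ((x + y + z) powr p - (y + z) powr p - (x + y) powr p + y powr p)"
      using zC conc unfolding C_def by (simp add: algebra_simps)
    also have "\<dots> = x * y * z * ?F"
      using mixed_diff_cleared[of x y z] pos unfolding s_def by simp
    finally show ?thesis by (rule nonneg_of_mult_nonneg) (use pos in simp)
  next
    case False
    have "2 * (x + y) powr p - 2 * y powr p - (x + 2 * y) powr p + (2 * y) powr p - x powr p
        = (2 * (1 + \<xi>) powr p - 2 - (2 + \<xi>) powr p + 2 powr p - \<xi> powr p) * y powr p"
    proof -
      have "(x + y) powr p = (1 + \<xi>) powr p * y powr p" "(x + 2 * y) powr p = (2 + \<xi>) powr p * y powr p"
        "x powr p = \<xi> powr p * y powr p"
        using \<xi> pos by (auto simp flip: powr_mult simp: algebra_simps)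
      then show ?thesis using Y2 by (simp add: algebra_simps)
    qed
    also have "\<dots> \<le> ((4 - 2 powr p) * \<xi>) * y powr p"
      using uniform_step_bound[of \<beta> \<xi>] b \<xi> unfolding p_def by (intro mult_right_mono) auto
    finally have K: "2 * (x + y) powr p - 2 * y powr p - (x + 2 * y) powr p + (2 * y) powr p - x powr p
        \<le> ((4 - 2 powr p) * \<xi>) * y powr p" .
    \<comment> \<open>In \<open>?F\<close> only this quotient depends on \<open>z\<close>; convexity
      bounds the chord slope from 0 to \<open>z\<close> below by the one from 0 to
      \<open>y\<close>.\<close>
    have "(powr_slope_diff p x y y - powr_slope_diff p x y 0) / y
        \<le> (powr_slope_diff p x y z - powr_slope_diff p x y 0) / z"
      using powr_slope_diff_slope_mono_left[of \<beta> x y 0 y z] b pos False by (simp add: p_def)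
    moreover have "?F = 2 * y powr p / (y * y) - ((x + y) powr p - y powr p - x powr p) / (y * x)
        + (powr_slope_diff p x y z - powr_slope_diff p x y 0) / z"
      using mixed_diff_slope_form[of "y powr p" y "(x + y) powr p" "x powr p" x
          "(y + z) powr p" "z powr p" z "(x + y + z) powr p"] b
      by (simp add: powr_slope_diff_def p_def add_ac)
    moreover have "x * y * y * (2 * y powr p / (y * y) - ((x + y) powr p - y powr p - x powr p) / (y * x)
        + (powr_slope_diff p x y y - powr_slope_diff p x y 0) / y)
      = (4 - 2 powr p) * \<xi> * y powr p * y
        - y * (2 * (x + y) powr p - 2 * y powr p - (x + 2 * y) powr p + (2 * y) powr p - x powr p)"
    proof -
      have e1: "powr_slope_diff p x y y - powr_slope_diff p x y 0 =
          ((x + 2 * y) powr p - (2 * y) powr p) / x - ((2 * y) powr p - y powr p) / y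
          - (((x + y) powr p - y powr p) / x - y powr p / y)"
      proof -
        have e: "y + x + y = x + 2 * y" "y + y = 2 * y" "0 + x + y = x + y" by simp_all
        show ?thesis unfolding powr_slope_diff_def e by simp
      qed
      have nz: "x \<noteq> 0" "y \<noteq> 0" using pos by auto
      show ?thesis
        unfolding e1 uniform_diff_cleared[OF nz] Y2 using \<xi>(2) by algebra
    qed
    then have "0 \<le> x * y * y * (2 * y powr p / (y * y) - ((x + y) powr p - y powr p - x powr p) / (y * x)
        + (powr_slope_diff p x y y - powr_slope_diff p x y 0) / y)"
      using mult_left_mono[OF K, of y] pos by (simp add: algebra_simps)
    then have "0 \<le> 2 * y powr p / (y * y) - ((x + y) powr p - y powr p - x powr p) / (y * x)
        + (powr_slope_diff p x y y - powr_slope_diff p x y 0) / y"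
      by (rule nonneg_of_mult_nonneg) (use pos in simp)
    ultimately show ?thesis by linarith
  qed
qed

section \<open>The kernel as a second difference of powers\<close>

text \<open>Nonnegativity of the integrand supplies integrability, so \<open>f\<close> may blow up
  at an endpoint, as \<open>omega\<close> does at \<open>s = v\<close>.\<close>

lemma interval_integral_FTC_nonneg_real:
  fixes f F :: "real \<Rightarrow> real"
  assumes "a < b" "continuous_on {a..b} F"
    and "\<And>x. a < x \<Longrightarrow> x < b \<Longrightarrow> (F has_real_derivative f x) (at x)"
    and "\<And>x. a < x \<Longrightarrow> x < b \<Longrightarrow> isCont f x"
    and "\<And>x. a < x \<Longrightarrow> x < b \<Longrightarrow> 0 \<le> f x"
  shows "(LBINT x=a..b. f x) = F b - F a"
proof (rule interval_integral_FTC_nonneg(2))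
  show "((F \<circ> real_of_ereal) \<longlongrightarrow> F a) (at_right (ereal a))"
    unfolding ereal_tendsto_simps using assms(1,2) by (rule continuous_on_Icc_at_rightD[rotated])
  show "((F \<circ> real_of_ereal) \<longlongrightarrow> F b) (at_left (ereal b))"
    unfolding ereal_tendsto_simps using assms(1,2) by (rule continuous_on_Icc_at_leftD[rotated])
qed (use assms in auto)

lemma integral_omega:
  fixes a b v \<beta> :: real
  assumes "0 < \<beta>" "a < b" "b \<le> v"
  shows "(LBINT s=a..b. omega \<beta> (v - s)) = ((v - a) powr \<beta> - (v - b) powr \<beta>) / (\<beta> * Gamma \<beta>)"
proof -
  have G1: "0 < Gamma \<beta>" using Gamma_real_pos[of \<beta>] assms by simp
  then have G: "0 < Gamma \<beta>" "Gamma \<beta> \<noteq> 0" by simp_all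
  have "(LBINT s=a..b. omega \<beta> (v - s)) =
      - ((v - b) powr \<beta>) / (\<beta> * Gamma \<beta>) - - ((v - a) powr \<beta>) / (\<beta> * Gamma \<beta>)"
  proof (rule interval_integral_FTC_nonneg_real[where F = "\<lambda>s. - ((v - s) powr \<beta>) / (\<beta> * Gamma \<beta>)"])
    show "continuous_on {a..b} (\<lambda>s. - ((v - s) powr \<beta>) / (\<beta> * Gamma \<beta>))"
      using assms G by (auto intro!: continuous_intros continuous_on_powr')
  qed (use assms G in \<open>auto intro!: derivative_eq_intros continuous_intros simp: omega_def\<close>)
  then show ?thesis by (simp add: diff_divide_distrib)
qed

text \<open>The difference of \<open>|s - t|^p\<close> over a grid rectangle. Absolute values make
  it symmetric in \<open>n\<close> and \<open>k\<close>; on the diagonal it is twice the power of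
  the step.\<close>

definition power_second_diff :: "real \<Rightarrow> (nat \<Rightarrow> real) \<Rightarrow> nat \<Rightarrow> nat \<Rightarrow> real" where
  "power_second_diff p t n k =
     \<bar>t n - t (k - 1)\<bar> powr p - \<bar>t n - t k\<bar> powr p
     - \<bar>t (n - 1) - t (k - 1)\<bar> powr p + \<bar>t (n - 1) - t k\<bar> powr p"

text \<open>Integrating \<open>omega\<close> twice raises the exponent to
  \<open>1 + \<beta>\<close>. For \<open>k < n\<close> the domain is a full rectangle; for
  \<open>k = n\<close> it is a triangle, which gives half of the symmetric second difference, and
  the factor 2 in \<open>kernel_b_mod\<close> lets one formula serve both.\<close>

lemma kernel_b_mod_eq:
  fixes t :: "nat \<Rightarrow> real"
  assumes b: "0 < \<beta>" "\<beta> < 1" and k: "1 \<le> k" "k \<le> n"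
    and mono: "\<And>i j. i < j \<Longrightarrow> j \<le> n \<Longrightarrow> t i < t j"
  shows "kernel_b_mod t \<beta> n (n - k) =
     power_second_diff (1 + \<beta>) t n k / (time_step t n * time_step t k * (\<beta> * (1 + \<beta>) * Gamma \<beta>))"
proof -
  have tn: "t (n - 1) < t n" and tk: "t (k - 1) < t k" using mono[of "n - 1" n] mono[of "k - 1" k] k by auto
  have le: "t (k - 1) \<le> t (n - 1)" 
  proof (cases "k = n")
    case False
    then have "k - 1 < n - 1" using k by linarith
    then show ?thesis using mono[of "k - 1" "n - 1"] by simp
  qed simp
  define c where "c = \<beta> * Gamma \<beta>"
  have c: "0 < c" using b by (simp add: c_def Gamma_real_pos)
  define J where "J = (LBINT v=t (n - 1)..t n. (LBINT s=t (k - 1)..min (t k) v. omega \<beta> (v - s)))"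
  have J1: "J = (LBINT v=t (n - 1)..t n. ((v - t (k - 1)) powr \<beta> - (v - min (t k) v) powr \<beta>) / c)"
    unfolding J_def
  proof (rule interval_integral_cong)
    fix v assume "v \<in> einterval (min (ereal (t (n - 1))) (ereal (t n))) (max (ereal (t (n - 1))) (ereal (t n)))"
    then have v: "t (n - 1) < v" "v < t n" using tn by (auto simp: einterval_def min_def max_def split: if_splits)
    then show "(LBINT s=t (k - 1)..min (t k) v. omega \<beta> (v - s)) =
        ((v - t (k - 1)) powr \<beta> - (v - min (t k) v) powr \<beta>) / c"
      unfolding c_def using integral_omega[of \<beta> "t (k - 1)" "min (t k) v" v] b v le tk by auto
  qed
  have J: "kernel_b_mod t \<beta> n (n - k) = (if k = n then 2 else 1) * J / (time_step t n * time_step t k)"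
    using k unfolding J_def kernel_b_mod_def kernel_b_def Let_def by auto
  have J_eq: "(if k = n then 2 else 1) * J = power_second_diff (1 + \<beta>) t n k / ((1 + \<beta>) * c)"
  proof (cases "k = n")
    case True
    \<comment> \<open>On the diagonal the inner integral ends at \<open>v\<close>, where it
      contributes \<open>0 powr \<beta> = 0\<close>.\<close>
    have "J = (LBINT v=t (n - 1)..t n. ((v - t (n - 1)) powr \<beta>) / c)"
      unfolding J1 True
    proof (rule interval_integral_cong)
      fix v assume "v \<in> einterval (min (ereal (t (n - 1))) (ereal (t n))) (max (ereal (t (n - 1))) (ereal (t n)))"
      then have v: "t (n - 1) < v" "v < t n" using tn by (auto simp: einterval_def min_def max_def split: if_splits)
      then show "((v - t (n - 1)) powr \<beta> - (v - min (t n) v) powr \<beta>) / c = (v - t (n - 1)) powr \<beta> / c"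
        using b by simp
    qed
    also have "\<dots> = (t n - t (n - 1)) powr (1 + \<beta>) / ((1 + \<beta>) * c)
        - (t (n - 1) - t (n - 1)) powr (1 + \<beta>) / ((1 + \<beta>) * c)"
    proof (rule interval_integral_FTC_nonneg_real[where F = "\<lambda>v. (v - t (n - 1)) powr (1 + \<beta>) / ((1 + \<beta>) * c)"])
      show "continuous_on {t (n - 1)..t n} (\<lambda>v. (v - t (n - 1)) powr (1 + \<beta>) / ((1 + \<beta>) * c))"
        using b c by (auto intro!: continuous_intros continuous_on_powr')
    qed (use b c tn in \<open>auto intro!: derivative_eq_intros continuous_intros\<close>)
    finally show ?thesis using True tn b by (simp add: power_second_diff_def abs_minus_commute)
  next
    case False
    then have kn: "k \<le> n - 1" using k by simp
    then have le': "t k \<le> t (n - 1)" using mono[of k "n - 1"] k by (cases "k = n - 1") auto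
    have "J = (LBINT v=t (n - 1)..t n. ((v - t (k - 1)) powr \<beta> - (v - t k) powr \<beta>) / c)"
      unfolding J1
    proof (rule interval_integral_cong)
      fix v assume "v \<in> einterval (min (ereal (t (n - 1))) (ereal (t n))) (max (ereal (t (n - 1))) (ereal (t n)))"
      then have v: "t (n - 1) < v" "v < t n" using tn by (auto simp: einterval_def min_def max_def split: if_splits)
      then show "((v - t (k - 1)) powr \<beta> - (v - min (t k) v) powr \<beta>) / c =
          ((v - t (k - 1)) powr \<beta> - (v - t k) powr \<beta>) / c"
        using le' by (simp add: min_def)
    qed
    also have "\<dots> = ((t n - t (k - 1)) powr (1 + \<beta>) - (t n - t k) powr (1 + \<beta>)) / ((1 + \<beta>) * c)
        - ((t (n - 1) - t (k - 1)) powr (1 + \<beta>) - (t (n - 1) - t k) powr (1 + \<beta>)) / ((1 + \<beta>) * c)"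
    proof (rule interval_integral_FTC_nonneg_real[where
          F = "\<lambda>v. ((v - t (k - 1)) powr (1 + \<beta>) - (v - t k) powr (1 + \<beta>)) / ((1 + \<beta>) * c)"])
      show "continuous_on {t (n - 1)..t n} (\<lambda>v. ((v - t (k - 1)) powr (1 + \<beta>) - (v - t k) powr (1 + \<beta>)) / ((1 + \<beta>) * c))"
        using b c le le' by (auto intro!: continuous_intros continuous_on_powr')
      show "((\<lambda>v. ((v - t (k - 1)) powr (1 + \<beta>) - (v - t k) powr (1 + \<beta>)) / ((1 + \<beta>) * c))
          has_real_derivative ((x - t (k - 1)) powr \<beta> - (x - t k) powr \<beta>) / c) (at x)"
        if "t (n - 1) < x" for x
      proof -
        have d: "((\<lambda>v. (v - y) powr (1 + \<beta>)) has_real_derivative (1 + \<beta>) * (x - y) powr \<beta>) (at x)"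
          if "y < x" for y
          using that by (auto intro!: derivative_eq_intros)
        have "((1 + \<beta>) * X - (1 + \<beta>) * Y) / ((1 + \<beta>) * c) = (X - Y) / c" for X Y
          unfolding right_diff_distrib[symmetric] using b by (intro mult_divide_mult_cancel_left) simp
        then show ?thesis
          using DERIV_cdivide[OF DERIV_diff[OF d[of "t (k - 1)"] d[of "t k"]], of "(1 + \<beta>) * c"] le le' that
          by simp
      qed
      show "0 \<le> ((x - t (k - 1)) powr \<beta> - (x - t k) powr \<beta>) / c" if "t (n - 1) < x" for x
        using b c le' tk that by (auto intro!: divide_nonneg_pos powr_mono2)
    qed (use b c tn tk le le' in \<open>auto intro!: continuous_intros\<close>)
    finally show ?thesis using False tn tk le le' b
      by (simp add: power_second_diff_def diff_divide_distrib add_divide_distrib)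
  qed
  show ?thesis unfolding J J_eq by (simp add: c_def mult_ac)
qed

lemma strict_mono_upto:
  fixes t :: "nat \<Rightarrow> 'b::order"
  assumes "\<And>k. k < N \<Longrightarrow> t k < t (k + 1)" "i < j" "j \<le> N"
  shows "t i < t j"
  using assms(2,3)
proof (induction j)
  case (Suc j)
  then show ?case using assms(1)[of j] by (cases "i = j") (auto intro: less_trans)
qed simp

section \<open>Signs of kernel differences\<close>

text \<open>Off the diagonal an entry is, up to a positive factor depending on \<open>k\<close>, a
  chord slope of \<open>v -> (v + x)^p - v^p\<close> with \<open>x\<close> the step of column
  \<open>k\<close>, between the distances from \<open>t k\<close> to the two ends of interval
  \<open>n\<close>.\<close>

lemma kernel_b_mod_eq_slope:
  fixes t :: "nat \<Rightarrow> real"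
  assumes b: "0 < \<beta>" "\<beta> < 1" and k: "1 \<le> k" "k < n"
    and mono: "\<And>i j. i < j \<Longrightarrow> j \<le> n \<Longrightarrow> t i < t j"
  defines "p \<equiv> 1 + \<beta>"
  shows "kernel_b_mod t \<beta> n (n - k) =
     ((t n - t k + time_step t k) powr p - (t n - t k) powr p
      - ((t (n - 1) - t k + time_step t k) powr p - (t (n - 1) - t k) powr p))
     / (t n - t (n - 1)) / (time_step t k * (\<beta> * (1 + \<beta>) * Gamma \<beta>))"
proof -
  have le: "t i \<le> t j" if "i \<le> j" "j \<le> n" for i j
    using mono[of i j] that by (cases "i = j") auto
  have "t k < t n" "t (k - 1) < t n" "t (k - 1) < t (n - 1)" "t k \<le> t (n - 1)"
    using mono[of k n] mono[of "k - 1" n] mono[of "k - 1" "n - 1"] le[of k "n - 1"] k by auto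
  then have "power_second_diff p t n k =
      (t n - t k + time_step t k) powr p - (t n - t k) powr p
      - ((t (n - 1) - t k + time_step t k) powr p - (t (n - 1) - t k) powr p)"
    by (simp add: power_second_diff_def time_step_def)
  then show ?thesis
    using kernel_b_mod_eq[OF b k(1) less_imp_le[OF k(2)] mono] by (simp add: p_def time_step_def)
qed

text \<open>In a fixed column, consecutive rows are consecutive chord slopes of one concave
  function. Column 1 gives the separate last coefficient of \<open>R_fun\<close>.\<close>

lemma kernel_b_mod_column_antimono:
  fixes t :: "nat \<Rightarrow> real"
  assumes b: "0 < \<beta>" "\<beta> < 1" and k: "1 \<le> k" "k < n"
    and mono: "\<And>i j. i < j \<Longrightarrow> j \<le> n + 1 \<Longrightarrow> t i < t j"
  shows "kernel_b_mod t \<beta> (n + 1) (n + 1 - k) \<le> kernel_b_mod t \<beta> n (n - k)"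
proof -
  have le: "t i \<le> t j" if "i \<le> j" "j \<le> n + 1" for i j
    using mono[of i j] that by (cases "i = j") auto
  have "time_step t k > 0" using mono[of "k - 1" k] k by (simp add: time_step_def)
  moreover have "t k \<le> t (n - 1)" "t (n - 1) < t n" "t n < t (n + 1)"
    using le[of k "n - 1"] mono[of "n - 1" n] mono[of n "n + 1"] k by auto
  moreover have "0 < time_step t k * (\<beta> * (1 + \<beta>) * Gamma \<beta>)"
    using b calculation(1) by (simp add: Gamma_real_pos)
  moreover have "kernel_b_mod t \<beta> n (n - k) =
     ((t n - t k + time_step t k) powr (1 + \<beta>) - (t n - t k) powr (1 + \<beta>)
      - ((t (n - 1) - t k + time_step t k) powr (1 + \<beta>) - (t (n - 1) - t k) powr (1 + \<beta>)))
     / (t n - t (n - 1)) / (time_step t k * (\<beta> * (1 + \<beta>) * Gamma \<beta>))"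
    using b k mono by (intro kernel_b_mod_eq_slope) auto
  moreover have "kernel_b_mod t \<beta> (n + 1) (n + 1 - k) =
     ((t (n + 1) - t k + time_step t k) powr (1 + \<beta>) - (t (n + 1) - t k) powr (1 + \<beta>)
      - ((t (n + 1 - 1) - t k + time_step t k) powr (1 + \<beta>) - (t (n + 1 - 1) - t k) powr (1 + \<beta>)))
     / (t (n + 1) - t (n + 1 - 1)) / (time_step t k * (\<beta> * (1 + \<beta>) * Gamma \<beta>))"
    using b k mono by (intro kernel_b_mod_eq_slope) auto
  ultimately show ?thesis
    using powr_increment_slope_antimono[of \<beta> "time_step t k" "t (n - 1) - t k" "t n - t k" "t (n + 1) - t k"] b
    by (simp only: add_diff_cancel_right') (intro divide_right_mono, auto)
qed

text \<open>Brings the difference of neighbouring columns in one row into chord-slope form, so that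
  convexity in the base point can compare two rows.\<close>

lemma powr_slope_diff_slope_eq_kernel:
  fixes t :: "nat \<Rightarrow> real"
  assumes b: "0 < \<beta>" "\<beta> < 1" and k: "1 \<le> k" "k + 1 < n"
    and mono: "\<And>i j. i < j \<Longrightarrow> j \<le> n \<Longrightarrow> t i < t j"
  shows "(powr_slope_diff (1 + \<beta>) (time_step t k) (time_step t (k + 1)) (t n - t (k + 1))
        - powr_slope_diff (1 + \<beta>) (time_step t k) (time_step t (k + 1)) (t (n - 1) - t (k + 1)))
        / (t n - t (n - 1)) / (\<beta> * (1 + \<beta>) * Gamma \<beta>)
      = kernel_b_mod t \<beta> n (n - k) - kernel_b_mod t \<beta> n (n - (k + 1))"
proof -
  have a: "v - t (k + 1) + time_step t (k + 1) = v - t k"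
    "v - t (k + 1) + time_step t k + time_step t (k + 1) = v - t k + time_step t k" for v
    by (simp_all add: time_step_def)
  have "kernel_b_mod t \<beta> n (n - k) =
     ((t n - t k + time_step t k) powr (1 + \<beta>) - (t n - t k) powr (1 + \<beta>)
      - ((t (n - 1) - t k + time_step t k) powr (1 + \<beta>) - (t (n - 1) - t k) powr (1 + \<beta>)))
     / (t n - t (n - 1)) / (time_step t k * (\<beta> * (1 + \<beta>) * Gamma \<beta>))"
    using b k mono by (intro kernel_b_mod_eq_slope) auto
  moreover have "kernel_b_mod t \<beta> n (n - (k + 1)) =
     ((t n - t (k + 1) + time_step t (k + 1)) powr (1 + \<beta>) - (t n - t (k + 1)) powr (1 + \<beta>)
      - ((t (n - 1) - t (k + 1) + time_step t (k + 1)) powr (1 + \<beta>) - (t (n - 1) - t (k + 1)) powr (1 + \<beta>)))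
     / (t n - t (n - 1)) / (time_step t (k + 1) * (\<beta> * (1 + \<beta>) * Gamma \<beta>))"
    using b k mono by (intro kernel_b_mod_eq_slope) auto
  ultimately show ?thesis
    unfolding powr_slope_diff_def a by (simp add: diff_divide_distrib mult_ac)
qed

text \<open>Rows \<open>n\<close> and \<open>n + 1\<close> give consecutive chord slopes of the
  convex function \<open>powr_slope_diff\<close>. The bound \<open>k + 1 < n\<close> keeps both
  columns off the diagonal, away from the doubled entry.\<close>

lemma kernel_b_mod_mixed_diff_far:
  fixes t :: "nat \<Rightarrow> real"
  assumes b: "0 < \<beta>" "\<beta> < 1" and k: "1 \<le> k" "k + 1 < n"
    and mono: "\<And>i j. i < j \<Longrightarrow> j \<le> n + 1 \<Longrightarrow> t i < t j"
  shows "0 \<le> kernel_b_mod t \<beta> n (n - (k + 1)) - kernel_b_mod t \<beta> n (n - k)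
     - kernel_b_mod t \<beta> (n + 1) (n + 1 - (k + 1)) + kernel_b_mod t \<beta> (n + 1) (n + 1 - k)"
proof -
  let ?E = "powr_slope_diff (1 + \<beta>) (time_step t k) (time_step t (k + 1))"
  have le: "t i \<le> t j" if "i \<le> j" "j \<le> n + 1" for i j
    using mono[of i j] that by (cases "i = j") auto
  have "time_step t k > 0" "time_step t (k + 1) > 0"
    using mono[of "k - 1" k] mono[of k "k + 1"] k by (auto simp: time_step_def)
  moreover have "t (k + 1) \<le> t (n - 1)" "t (n - 1) < t n" "t n < t (n + 1)"
    using le[of "k + 1" "n - 1"] mono[of "n - 1" n] mono[of n "n + 1"] k by auto
  ultimately have "(?E (t n - t (k + 1)) - ?E (t (n - 1) - t (k + 1))) / (t n - t (n - 1))
      \<le> (?E (t (n + 1) - t (k + 1)) - ?E (t n - t (k + 1))) / (t (n + 1) - t n)"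
    using powr_slope_diff_slope_mono[of \<beta> "time_step t k" "time_step t (k + 1)"
      "t (n - 1) - t (k + 1)" "t n - t (k + 1)" "t (n + 1) - t (k + 1)"] b by simp
  then have "(?E (t n - t (k + 1)) - ?E (t (n - 1) - t (k + 1))) / (t n - t (n - 1)) / (\<beta> * (1 + \<beta>) * Gamma \<beta>)
      \<le> (?E (t (n + 1) - t (k + 1)) - ?E (t n - t (k + 1))) / (t (n + 1) - t n) / (\<beta> * (1 + \<beta>) * Gamma \<beta>)"
    using b by (intro divide_right_mono) (auto intro!: mult_nonneg_nonneg Gamma_real_nonneg less_imp_le[OF Gamma_real_pos])
  moreover have "(?E (t n - t (k + 1)) - ?E (t (n - 1) - t (k + 1))) / (t n - t (n - 1)) / (\<beta> * (1 + \<beta>) * Gamma \<beta>)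
      = kernel_b_mod t \<beta> n (n - k) - kernel_b_mod t \<beta> n (n - (k + 1))"
    using b k mono by (intro powr_slope_diff_slope_eq_kernel) auto
  moreover have "(?E (t (n + 1) - t (k + 1)) - ?E (t (n + 1 - 1) - t (k + 1))) / (t (n + 1) - t (n + 1 - 1)) / (\<beta> * (1 + \<beta>) * Gamma \<beta>)
      = kernel_b_mod t \<beta> (n + 1) (n + 1 - k) - kernel_b_mod t \<beta> (n + 1) (n + 1 - (k + 1))"
    using b k mono by (intro powr_slope_diff_slope_eq_kernel) auto
  ultimately show ?thesis by simp
qed

text \<open>The doubled diagonal entry of row \<open>n\<close> occurs here, which the chord-slope
  form does not cover. With \<open>x, y, z\<close> the steps \<open>n - 1\<close>, \<open>n\<close>,
  \<open>n + 1\<close>, the four entries are the terms of \<open>adjacent_kernel_bound\<close> up to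
  a common positive factor.\<close>

lemma kernel_b_mod_mixed_diff_near:
  fixes t :: "nat \<Rightarrow> real"
  assumes b: "0 < \<beta>" "\<beta> < 1" and n: "2 \<le> n"
    and mono: "\<And>i j. i < j \<Longrightarrow> j \<le> n + 1 \<Longrightarrow> t i < t j"
    and ratio: "H_fun \<beta> (step_ratio t n) \<le> step_ratio t (n + 1)"
  shows "0 \<le> kernel_b_mod t \<beta> n (n - n) - kernel_b_mod t \<beta> n (n - (n - 1))
     - kernel_b_mod t \<beta> (n + 1) (n + 1 - n) + kernel_b_mod t \<beta> (n + 1) (n + 1 - (n - 1))"
proof -
  define p where "p = 1 + \<beta>"
  obtain m where m: "n = Suc (Suc m)" using n by (metis add_2_eq_Suc le_Suc_ex)
  define x y z where "x = time_step t (Suc m)" and "y = time_step t n" and "z = time_step t (Suc n)"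
  define c where "c = \<beta> * p * Gamma \<beta>"
  have pos: "0 < x" "0 < y" "0 < z"
    using mono[of m "Suc m"] mono[of "Suc m" n] mono[of n "Suc n"]
    by (auto simp: x_def y_def z_def time_step_def m)
  have c: "0 < c" using b by (simp add: c_def p_def Gamma_real_pos)
  have e: "t (Suc m) = t m + x" "t (Suc (Suc m)) = t m + x + y" "t (Suc (Suc (Suc m))) = t m + x + y + z"
    by (simp_all add: x_def y_def z_def time_step_def m)
  have K: "kernel_b_mod t \<beta> i (i - k) = power_second_diff p t i k / (time_step t i * time_step t k * c)"
    if "1 \<le> k" "k \<le> i" "i \<le> n + 1" for i k
    unfolding p_def c_def using b that mono by (intro kernel_b_mod_eq) auto
  have ts: "time_step t (Suc m) = x" "time_step t (Suc (Suc m)) = y" "time_step t (Suc (Suc (Suc m))) = z"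
    by (simp_all add: x_def y_def z_def m)
  have "kernel_b_mod t \<beta> n (n - n) = 2 * y powr p / (y * y) / c"
    using K[of n n] pos b by (simp add: power_second_diff_def m ts e p_def)
  moreover have "kernel_b_mod t \<beta> n (n - (n - 1)) = ((x + y) powr p - y powr p - x powr p) / (y * x) / c"
    using K[of "n - 1" n] pos b by (simp add: power_second_diff_def m ts e p_def)
  moreover have "kernel_b_mod t \<beta> (n + 1) (n + 1 - n) = ((y + z) powr p - y powr p - z powr p) / (z * y) / c"
    using K[of n "n + 1"] pos b by (simp add: power_second_diff_def m ts e p_def algebra_simps)
  moreover have "kernel_b_mod t \<beta> (n + 1) (n + 1 - (n - 1)) =
      ((x + y + z) powr p - (y + z) powr p - (x + y) powr p + y powr p) / (z * x) / c"
    using K[of "n - 1" "n + 1"] pos b by (simp add: power_second_diff_def m ts e p_def add.assoc)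
  moreover have "H_fun \<beta> (y / x) \<le> z / y"
    using ratio by (simp add: step_ratio_def m ts)
  then have "0 \<le> (2 * y powr p / (y * y) - ((x + y) powr p - y powr p - x powr p) / (y * x)
     - ((y + z) powr p - y powr p - z powr p) / (z * y)
     + ((x + y + z) powr p - (y + z) powr p - (x + y) powr p + y powr p) / (z * x)) / c"
    unfolding p_def using b pos c by (intro divide_nonneg_pos adjacent_kernel_bound) auto
  ultimately show ?thesis by (simp only: add_divide_distrib diff_divide_distrib)
qed

section \<open>Positive semidefiniteness\<close>

text \<open>The density that represents \<open>|s|^p\<close> as an integral of
  \<open>1 - cos (s x)\<close>; scaling forces the exponent \<open>- p - 1\<close>.\<close>

definition fourier_weight :: "real \<Rightarrow> real \<Rightarrow> real" where
  "fourier_weight p x = indicator {0<..} x * x powr (- p - 1)"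

lemma fourier_weight_nonneg: "0 \<le> fourier_weight p x"
  by (simp add: fourier_weight_def indicator_def)

lemma fourier_weight_measurable [measurable]: "fourier_weight p \<in> borel_measurable borel"
  unfolding fourier_weight_def by measurable

lemma one_minus_cos_le: "1 - cos x \<le> x\<^sup>2 / 2" for x :: real
proof -
  have "1 - cos x = 2 * (sin (x / 2))\<^sup>2"
    using cos_double_sin[of "x / 2"] by simp
  also have "(sin (x / 2))\<^sup>2 \<le> (x / 2)\<^sup>2"
    using abs_sin_x_le_abs_x[of "x / 2"] by (simp only: abs_le_square_iff)
  finally show ?thesis by (simp add: power_divide)
qed

text \<open>Near 0 the quadratic vanishing of \<open>1 - cos x\<close> leaves
  \<open>x^(1 - p)\<close>, integrable as \<open>p < 2\<close>; at infinity boundedness leaves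
  \<open>x^(- p - 1)\<close>, integrable as \<open>p > 0\<close>.\<close>

lemma integrable_one_minus_cos:
  assumes p: "0 < p" "p < 2"
  shows "integrable lborel (\<lambda>x. (1 - cos x) * fourier_weight p x)"
proof -
  have 1: "set_integrable lborel (einterval 0 1) (\<lambda>x. x powr (1 - p))"
  proof (rule interval_integral_FTC_nonneg(1)[where F = "\<lambda>x. x powr (2 - p) / (2 - p)"])
    have "((\<lambda>x. x powr (2 - p) / (2 - p)) \<longlongrightarrow> 0 powr (2 - p) / (2 - p)) (at_right 0)"
      by (rule continuous_on_Icc_at_rightD[where b = 1])
        (use p in \<open>auto intro!: continuous_intros continuous_on_powr'\<close>)
    then show "(((\<lambda>x. x powr (2 - p) / (2 - p)) \<circ> real_of_ereal) \<longlongrightarrow> 0 powr (2 - p) / (2 - p)) (at_right 0)"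
      unfolding zero_ereal_def ereal_tendsto_simps .
    have "((\<lambda>x. x powr (2 - p) / (2 - p)) \<longlongrightarrow> 1 powr (2 - p) / (2 - p)) (at_left 1)"
      by (rule continuous_on_Icc_at_leftD[where a = 0])
        (use p in \<open>auto intro!: continuous_intros continuous_on_powr'\<close>)
    then show "(((\<lambda>x. x powr (2 - p) / (2 - p)) \<circ> real_of_ereal) \<longlongrightarrow> 1 powr (2 - p) / (2 - p)) (at_left 1)"
      unfolding one_ereal_def ereal_tendsto_simps .
    show "((\<lambda>x. x powr (2 - p) / (2 - p)) has_real_derivative x powr (1 - p)) (at x)" if "0 < ereal x" for x
      using that p by (auto intro!: derivative_eq_intros)
    show "isCont (\<lambda>x. x powr (1 - p)) x" if "0 < ereal x" for x
      using that by (auto intro!: continuous_intros)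
  qed auto
  \<comment> \<open>The intervals are open, so starting at 1/2 rather than 1 lets the two cover all
    positive reals, the point 1 included.\<close>
  have 2: "set_integrable lborel (einterval (ereal (1/2)) \<infinity>) (\<lambda>x. x powr (- p - 1))"
  proof (rule interval_integral_FTC_nonneg(1)[where F = "\<lambda>x. - (x powr (- p)) / p"])
    have "((\<lambda>x. - (x powr (- p)) / p) \<longlongrightarrow> - ((1/2) powr (- p)) / p) (at_right (1/2))"
      by (rule continuous_on_Icc_at_rightD[where b = 1])
        (use p in \<open>auto intro!: continuous_intros continuous_on_powr'\<close>)
    then show "(((\<lambda>x. - (x powr (- p)) / p) \<circ> real_of_ereal) \<longlongrightarrow> - ((1/2) powr (- p)) / p) (at_right (ereal (1/2)))"
      unfolding ereal_tendsto_simps .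
    have "((\<lambda>x. - (x powr (- p)) / p) \<longlongrightarrow> - 0 / p) at_top"
      using p by (intro tendsto_intros tendsto_neg_powr filterlim_ident) auto
    then show "(((\<lambda>x. - (x powr (- p)) / p) \<circ> real_of_ereal) \<longlongrightarrow> - 0 / p) (at_left \<infinity>)"
      unfolding ereal_tendsto_simps .
    have pos: "0 < x" if "ereal (1/2) < ereal x" for x
      using that by (cases "0 < x") auto
    show "((\<lambda>x. - (x powr (- p)) / p) has_real_derivative x powr (- p - 1)) (at x)" if "ereal (1/2) < ereal x" for x
      using pos[OF that] p by (auto intro!: derivative_eq_intros)
    show "isCont (\<lambda>x. x powr (- p - 1)) x" if "ereal (1/2) < ereal x" for x
      using pos[OF that] by (auto intro!: continuous_intros)
  qed auto
  have half: "x \<in> einterval (ereal (1/2)) \<infinity>" if "1 / 2 < x" for x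
    using that by (simp add: einterval_def)
  have "integrable lborel (\<lambda>x. indicator (einterval 0 1) x * x powr (1 - p) +
      2 * (indicator (einterval (ereal (1/2)) \<infinity>) x * x powr (- p - 1)))"
    using 1 2 unfolding set_integrable_def by (intro Bochner_Integration.integrable_add) auto
  then show ?thesis
  proof (rule Bochner_Integration.integrable_bound)
    show "AE x in lborel. norm ((1 - cos x) * fourier_weight p x) \<le>
       norm (indicator (einterval 0 1) x * x powr (1 - p) + 2 * (indicator (einterval (ereal (1/2)) \<infinity>) x * x powr (- p - 1)))"
    proof (rule AE_I2)
      fix x :: real
      have cos: "0 \<le> 1 - cos x" "1 - cos x \<le> 2" using cos_ge_minus_one[of x] by auto
      show "norm ((1 - cos x) * fourier_weight p x) \<le>
         norm (indicator (einterval 0 1) x * x powr (1 - p) + 2 * (indicator (einterval (ereal (1/2)) \<infinity>) x * x powr (- p - 1)))"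
      proof (cases "0 < x")
        case True
        show ?thesis
        proof (cases "x < 1")
          case True
          have "(1 - cos x) * x powr (- p - 1) \<le> x\<^sup>2 * x powr (- p - 1)"
            using one_minus_cos_le[of x] zero_le_power2[of x] by (intro mult_right_mono) (linarith, simp)
          also have "\<dots> = x powr (1 - p)"
            using \<open>0 < x\<close> by (simp add: powr_add[symmetric] flip: powr_numeral)
          finally show ?thesis
            using True \<open>0 < x\<close> cos
            by (auto simp: fourier_weight_def indicator_def einterval_def abs_mult intro: add_increasing2)
        next
          case False
          have "(1 - cos x) * x powr (- p - 1) \<le> 2 * x powr (- p - 1)"
            using cos by (intro mult_right_mono) auto
          then show ?thesis using False \<open>0 < x\<close> cos half[of x]
            by (auto simp: fourier_weight_def indicator_def einterval_def abs_mult)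
        qed
      qed (simp add: fourier_weight_def)
    qed
  qed measurable
qed

lemma
  fixes p s :: real
  assumes p: "0 < p" "p < 2"
  shows integrable_one_minus_cos_scaled: "integrable lborel (\<lambda>x. (1 - cos (s * x)) * fourier_weight p x)"
    and integral_one_minus_cos_scaled: "(LINT x|lborel. (1 - cos (s * x)) * fourier_weight p x)
      = \<bar>s\<bar> powr p * (LINT x|lborel. (1 - cos x) * fourier_weight p x)"
proof -
  let ?f = "\<lambda>x. (1 - cos x) * fourier_weight p x"
  have "integrable lborel (\<lambda>x. (1 - cos (s * x)) * fourier_weight p x) \<and>
     (LINT x|lborel. (1 - cos (s * x)) * fourier_weight p x) = \<bar>s\<bar> powr p * integral\<^sup>L lborel ?f"
  proof (cases "s = 0")
    case False
    have cos: "cos (\<bar>s\<bar> * x) = cos (s * x)" for x by (cases "0 \<le> s") auto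
    have eq: "?f (0 + \<bar>s\<bar> * x) = \<bar>s\<bar> powr (- p - 1) * ((1 - cos (s * x)) * fourier_weight p x)" for x
      using False cos[of x] by (auto simp: fourier_weight_def indicator_def powr_mult zero_less_mult_iff)
    have "integrable lborel (\<lambda>x. ?f (0 + \<bar>s\<bar> * x))"
      using integrable_one_minus_cos[OF p] False by (intro lborel_integrable_real_affine) auto
    then have int: "integrable lborel (\<lambda>x. (1 - cos (s * x)) * fourier_weight p x)"
      unfolding eq using False by simp
    have "integral\<^sup>L lborel ?f = \<bar>s\<bar> * (LINT x|lborel. ?f (0 + \<bar>s\<bar> * x))"
      using lborel_integral_real_affine[of "\<bar>s\<bar>" ?f 0] False by simp
    also have "\<dots> = \<bar>s\<bar> powr (- p) * (LINT x|lborel. (1 - cos (s * x)) * fourier_weight p x)"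
      unfolding eq using False powr_mult_base[of "\<bar>s\<bar>" "- p - 1"] by simp
    finally show ?thesis using False int by (simp add: powr_minus)
  qed simp
  then show "integrable lborel (\<lambda>x. (1 - cos (s * x)) * fourier_weight p x)"
    "(LINT x|lborel. (1 - cos (s * x)) * fourier_weight p x) = \<bar>s\<bar> powr p * integral\<^sup>L lborel ?f"
    by auto
qed

text \<open>Strict positivity is what allows division by this constant; a lower bound comes from
  \<open>[pi/2, pi]\<close>, where the cosine is nonpositive.\<close>

lemma integral_one_minus_cos_pos:
  assumes p: "0 < p" "p < 2"
  shows "0 < (LINT x|lborel. (1 - cos x) * fourier_weight p x)"
proof -
  have "0 < (pi - pi / 2) * pi powr (- p - 1)" by simp
  also have "\<dots> = (LINT x|lborel. indicator {pi/2..pi} x * pi powr (- p - 1))" by simp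
  also have "\<dots> \<le> (LINT x|lborel. (1 - cos x) * fourier_weight p x)"
  proof (rule integral_mono)
    fix x :: real
    show "indicator {pi/2..pi} x * pi powr (- p - 1) \<le> (1 - cos x) * fourier_weight p x"
    proof (cases "x \<in> {pi/2..pi}")
      case True
      then have x: "0 < x" using pi_gt_zero by (auto intro: less_le_trans[of 0 "pi/2"])
      have "cos x \<le> cos (pi / 2)"
        using True by (intro cos_monotone_0_pi_le) auto
      then have "1 * pi powr (- p - 1) \<le> (1 - cos x) * x powr (- p - 1)"
        using True x p by (intro mult_mono powr_mono2') auto
      then show ?thesis using True x by (simp add: fourier_weight_def)
    qed (use fourier_weight_nonneg in simp)
  qed (use p integrable_one_minus_cos in auto)
  finally show ?thesis .
qed

text \<open>The rectangle difference of the cosine of a difference splits into products of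
  one-variable differences, so its negative is a Gram kernel: the source of positivity.\<close>

lemma cos_second_diff:
  fixes a b c d :: real
  shows "cos (a - d) + cos (b - c) - cos (a - c) - cos (b - d) + ((cos a - cos b) * (cos c - cos d)
     + (sin a - sin b) * (sin c - sin d)) = 0"
  by (simp add: cos_diff algebra_simps)

text \<open>The kernel \<open>- \<bar>s - t\<bar>\<^sup>p\<close> is conditionally positive definite for \<open>0 < p < 2\<close>: up to a
  positive factor \<open>\<bar>s\<bar>\<^sup>p\<close> is the integral of \<open>1 - cos (s x)\<close> against a nonnegative weight.\<close>

lemma power_second_diff_psd:
  fixes t v :: "nat \<Rightarrow> real"
  assumes p: "0 < p" "p < 2"
  shows "0 \<le> (\<Sum>n\<in>I. \<Sum>k\<in>I. power_second_diff p t n k * v n * v k)"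
proof -
  define C where "C = (LINT x|lborel. (1 - cos x) * fourier_weight p x)"
  define g where "g = (\<lambda>s x. (1 - cos (s * x)) * fourier_weight p x)"
  define G where "G = (\<lambda>n k x. g (t n - t (k - 1)) x - g (t n - t k) x
     - g (t (n - 1) - t (k - 1)) x + g (t (n - 1) - t k) x)"
  have C: "0 < C" unfolding C_def by (rule integral_one_minus_cos_pos[OF p])
  have int_g: "integrable lborel (g s)" and g: "integral\<^sup>L lborel (g s) = \<bar>s\<bar> powr p * C" for s
    unfolding g_def C_def by (intro integrable_one_minus_cos_scaled integral_one_minus_cos_scaled p)+
  have int_G: "integrable lborel (G n k)" for n k
    unfolding G_def by (intro Bochner_Integration.integrable_add Bochner_Integration.integrable_diff int_g)
  have G: "integral\<^sup>L lborel (G n k) = power_second_diff p t n k * C" for n k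
    unfolding G_def power_second_diff_def by (simp add: int_g g algebra_simps)
  \<comment> \<open>For each fixed \<open>x\<close> the form is already a nonnegative weight times a
    sum of two squares.\<close>
  have "0 \<le> (\<Sum>n\<in>I. \<Sum>k\<in>I. G n k x * v n * v k)" for x
  proof -
    define c where "c = (\<lambda>n. cos (t n * x) - cos (t (n - 1) * x))"
    define s where "s = (\<lambda>n. sin (t n * x) - sin (t (n - 1) * x))"
    have "G n k x = (c n * c k + s n * s k) * fourier_weight p x" for n k
    proof -
      have "(1 - cos ((t n - t (k - 1)) * x)) - (1 - cos ((t n - t k) * x))
          - (1 - cos ((t (n - 1) - t (k - 1)) * x)) + (1 - cos ((t (n - 1) - t k) * x))
          = c n * c k + s n * s k"
        using cos_second_diff[of "t n * x" "t (k - 1) * x" "t (n - 1) * x" "t k * x"]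
        by (simp add: c_def s_def left_diff_distrib)
      then show ?thesis unfolding G_def g_def by algebra
    qed
    then have "(\<Sum>n\<in>I. \<Sum>k\<in>I. G n k x * v n * v k) =
        fourier_weight p x * ((\<Sum>n\<in>I. c n * v n) * (\<Sum>k\<in>I. c k * v k) + (\<Sum>n\<in>I. s n * v n) * (\<Sum>k\<in>I. s k * v k))"
      unfolding sum_product by (simp add: sum.distrib[symmetric] sum_distrib_left algebra_simps)
    then show ?thesis by (simp add: fourier_weight_nonneg)
  qed
  then have "0 \<le> (LINT x|lborel. (\<Sum>n\<in>I. \<Sum>k\<in>I. G n k x * v n * v k))"
    by (intro Bochner_Integration.integral_nonneg)
  also have "\<dots> = C * (\<Sum>n\<in>I. \<Sum>k\<in>I. power_second_diff p t n k * v n * v k)"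
    using int_G G by (simp add: sum_distrib_left algebra_simps)
  finally show ?thesis using C by (simp add: zero_le_mult_iff)
qed

lemma power_second_diff_sym: "power_second_diff p t n k = power_second_diff p t k n"
  unfolding power_second_diff_def abs_minus_commute[of "t k"] abs_minus_commute[of "t (k - 1)"] by simp

lemma sum_symmetric_square:
  fixes f :: "nat \<Rightarrow> nat \<Rightarrow> 'b::comm_semiring_1"
  assumes "\<And>n k. f n k = f k n"
  shows "(\<Sum>n=1..m. \<Sum>k=1..m. f n k) = (\<Sum>n=1..m. (\<Sum>k=1..n. (if k = n then 1 else 2) * f n k))"
proof (induction m)
  case (Suc m)
  have "(\<Sum>n=1..Suc m. \<Sum>k=1..Suc m. f n k) =
      (\<Sum>n=1..m. \<Sum>k=1..m. f n k) + ((\<Sum>k=1..m. f (Suc m) k) + (\<Sum>k=1..m. f (Suc m) k) + f (Suc m) (Suc m))"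
  proof -
    have "(\<Sum>n=1..m. f n (Suc m)) = (\<Sum>k=1..m. f (Suc m) k)"
      by (intro sum.cong refl assms)
    then show ?thesis by (simp add: sum.distrib add_ac)
  qed
  also have "(\<Sum>k=1..m. f (Suc m) k) + (\<Sum>k=1..m. f (Suc m) k) =
      (\<Sum>k=1..m. (if k = Suc m then 1 else 2) * f (Suc m) k)"
    unfolding sum.distrib[symmetric] by (intro sum.cong refl) (auto simp: mult_2)
  finally show ?case using Suc by simp
qed simp

text \<open>Up to a positive factor, the lower triangular sum is the full symmetric form of second
  differences in \<open>w n / time_step t n\<close>: off-diagonal terms count twice, diagonal ones
  once with the kernel already doubled.\<close>

lemma kernel_b_sum_nonneg:
  fixes t w :: "nat \<Rightarrow> real"
  assumes b: "0 < \<beta>" "\<beta> < 1"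
    and mono: "\<And>i j. i < j \<Longrightarrow> j \<le> m \<Longrightarrow> t i < t j"
  shows "0 \<le> (\<Sum>n=1..m. w n * (\<Sum>k=1..n. kernel_b t \<beta> n (n - k) * w k))"
proof -
  define c where "c = \<beta> * (1 + \<beta>) * Gamma \<beta>"
  define v where "v = (\<lambda>n. w n / time_step t n)"
  define f where "f = (\<lambda>n k. power_second_diff (1 + \<beta>) t n k * v n * v k)"
  have c: "0 < c" using b by (simp add: c_def Gamma_real_pos)
  have "2 * c * (w n * (kernel_b t \<beta> n (n - k) * w k)) = (if k = n then 1 else 2) * f n k"
    if "n \<in> {1..m}" "k \<in> {1..n}" for n k
  proof -
    have "(if k = n then 2 else 1) * kernel_b t \<beta> n (n - k) = kernel_b_mod t \<beta> n (n - k)"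
      using that by (auto simp: kernel_b_mod_def)
    also have "\<dots> = power_second_diff (1 + \<beta>) t n k / (time_step t n * time_step t k * c)"
      unfolding c_def using b that mono by (intro kernel_b_mod_eq) auto
    finally have "f n k = c * (w n * ((if k = n then 2 else 1) * kernel_b t \<beta> n (n - k) * w k))"
      using c by (simp add: f_def v_def)
    then show ?thesis by simp
  qed
  then have "2 * c * (\<Sum>n=1..m. w n * (\<Sum>k=1..n. kernel_b t \<beta> n (n - k) * w k)) =
      (\<Sum>n=1..m. \<Sum>k=1..n. (if k = n then 1 else 2) * f n k)"
    unfolding sum_distrib_left by (intro sum.cong refl) auto
  also have "\<dots> = (\<Sum>n=1..m. \<Sum>k=1..m. f n k)"
    by (rule sum_symmetric_square[symmetric]) (simp add: f_def power_second_diff_sym[of _ t] mult_ac)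
  also have "\<dots> \<ge> 0"
    unfolding f_def using b by (intro power_second_diff_psd) auto
  finally show ?thesis using c by (simp add: zero_le_mult_iff)
qed

section \<open>Periodic functions on a box\<close>

lemma set_integrable_box_continuous:
  fixes f :: "'a::euclidean_space \<Rightarrow> real"
  assumes "continuous_on UNIV f"
  shows "set_integrable lborel (box a b) f"
proof -
  have "set_integrable lborel (cbox a b) f"
    unfolding set_integrable_def
    using assms by (intro borel_integrable_compact) (auto intro: continuous_on_subset)
  then show ?thesis by (rule set_integrable_subset) (auto intro: box_subset_cbox[THEN subsetD])
qed

text \<open>Passes to the gauge integral on the closed box, where splitting, translation and
  differentiation under the integral are at hand.\<close>

lemma LINT_box_eq_integral:
  fixes f :: "'a::euclidean_space \<Rightarrow> real"
  assumes "continuous_on UNIV f"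
  shows "(LINT x:box a b|lborel. f x) = integral (cbox a b) f"
  using set_borel_integral_eq_integral(2)[OF set_integrable_box_continuous[OF assms]]
  by (simp add: integral_open_interval)

text \<open>The scheme is imposed only inside the box; the boundary is negligible.\<close>

lemma integral_cbox_cong_box:
  fixes f g :: "'a::euclidean_space \<Rightarrow> real"
  assumes "\<And>x. x \<in> box a b \<Longrightarrow> f x = g x"
  shows "integral (cbox a b) f = integral (cbox a b) g"
  using assms unfolding integral_open_interval[symmetric] by (rule integral_cong)

lemma integrable_on_cbox_continuous:
  fixes f :: "'a::euclidean_space \<Rightarrow> real"
  shows "continuous_on UNIV f \<Longrightarrow> f integrable_on cbox a b"
  by (intro integrable_continuous) (auto intro: continuous_on_subset)

lemma cbox_Int_halfspaces:
  fixes u v k :: "'a::euclidean_space"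
  assumes "k \<in> Basis"
  shows "c \<le> v \<bullet> k \<Longrightarrow> cbox u v \<inter> {x. x \<bullet> k \<le> c} = cbox u (v + (c - v \<bullet> k) *\<^sub>R k)"
    and "u \<bullet> k \<le> c \<Longrightarrow> cbox u v \<inter> {x. c \<le> x \<bullet> k} = cbox (u + (c - u \<bullet> k) *\<^sub>R k) v"
  using assms by (auto simp: mem_box inner_simps inner_Basis split: if_splits) force+

text \<open>Cut the cell at distance \<open>s\<close> from its lower face and move the lower slab up
  by one period; the two pieces then form the translated cell.\<close>

lemma integral_cbox_periodic_shift:
  fixes f :: "'a::euclidean_space \<Rightarrow> real"
  assumes cont: "continuous_on UNIV f" and per: "box_periodic a b f" and k: "k \<in> Basis"
    and s: "0 \<le> s" "s \<le> (b - a) \<bullet> k"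
  shows "integral (cbox a b) (\<lambda>x. f (x + s *\<^sub>R k)) = integral (cbox a b) f"
proof -
  define L where "L = (b - a) \<bullet> k"
  define b' where "b' = b + (s - L) *\<^sub>R k"
  have int: "f integrable_on cbox u v" for u v
    by (rule integrable_on_cbox_continuous[OF cont])
  have kk: "k \<bullet> k = 1" using k by simp
  have "integral (cbox a b) f = integral (cbox a b \<inter> {x. x \<bullet> k \<le> a \<bullet> k + s}) f
      + integral (cbox a b \<inter> {x. a \<bullet> k + s \<le> x \<bullet> k}) f"
    using integral_split[OF int k, of a b "a \<bullet> k + s"] by simp
  also have "cbox a b \<inter> {x. x \<bullet> k \<le> a \<bullet> k + s} = cbox a b'"
    using cbox_Int_halfspaces(1)[OF k, of "a \<bullet> k + s" b a] s
    by (simp add: b'_def L_def inner_diff_left algebra_simps)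
  also have "cbox a b \<inter> {x. a \<bullet> k + s \<le> x \<bullet> k} = cbox (a + s *\<^sub>R k) b"
    using cbox_Int_halfspaces(2)[OF k, of a "a \<bullet> k + s" b] s by simp
  also have "integral (cbox a b') f = integral (cbox a b') (\<lambda>x. f (x + L *\<^sub>R k))"
    using per k by (simp add: box_periodic_def L_def)
  also have "\<dots> = integral (cbox (a + L *\<^sub>R k) (b' + L *\<^sub>R k)) f"
    unfolding integral_shift_cbox_plus[symmetric] by (simp add: o_def add.commute)
  also have "cbox (a + L *\<^sub>R k) (b' + L *\<^sub>R k) = cbox (a + s *\<^sub>R k) (b + s *\<^sub>R k) \<inter> {x. b \<bullet> k \<le> x \<bullet> k}"
  proof -
    have "a + s *\<^sub>R k + (b \<bullet> k - (a + s *\<^sub>R k) \<bullet> k) *\<^sub>R k = a + L *\<^sub>R k" "b' + L *\<^sub>R k = b + s *\<^sub>R k"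
      using kk by (simp_all add: b'_def L_def inner_add_left inner_diff_left algebra_simps)
    moreover have "cbox (a + s *\<^sub>R k) (b + s *\<^sub>R k) \<inter> {x. b \<bullet> k \<le> x \<bullet> k} =
        cbox (a + s *\<^sub>R k + (b \<bullet> k - (a + s *\<^sub>R k) \<bullet> k) *\<^sub>R k) (b + s *\<^sub>R k)"
      using s kk by (intro cbox_Int_halfspaces(2)[OF k]) (simp add: inner_add_left inner_diff_left)
    ultimately show ?thesis by (simp only:)
  qed
  also have "cbox (a + s *\<^sub>R k) b = cbox (a + s *\<^sub>R k) (b + s *\<^sub>R k) \<inter> {x. x \<bullet> k \<le> b \<bullet> k}"
    using cbox_Int_halfspaces(1)[OF k, of "b \<bullet> k" "b + s *\<^sub>R k" "a + s *\<^sub>R k"] s kk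
    by (simp add: inner_add_left)
  also have "integral (cbox (a + s *\<^sub>R k) (b + s *\<^sub>R k) \<inter> {x. b \<bullet> k \<le> x \<bullet> k}) f
      + integral (cbox (a + s *\<^sub>R k) (b + s *\<^sub>R k) \<inter> {x. x \<bullet> k \<le> b \<bullet> k}) f
      = integral (cbox (a + s *\<^sub>R k) (b + s *\<^sub>R k)) f"
    using integral_split[OF int k, of "a + s *\<^sub>R k" "b + s *\<^sub>R k" "b \<bullet> k"] by simp
  also have "\<dots> = integral (cbox a b) (\<lambda>x. f (x + s *\<^sub>R k))"
    unfolding integral_shift_cbox_plus[symmetric] by (simp add: o_def add.commute)
  finally show ?thesis by simp
qed

section \<open>Partial derivatives and Green's formula\<close>

lemma differentiable_imp_continuous_on_UNIV:
  fixes f :: "'a::euclidean_space \<Rightarrow> real"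
  shows "(\<And>x. f differentiable (at x)) \<Longrightarrow> continuous_on UNIV f"
  by (auto intro: continuous_at_imp_continuous_on differentiable_imp_continuous_within)

lemma partial_deriv_eqI:
  assumes "(f has_derivative D) (at x)"
  shows "partial_deriv i f x = D i"
  using frechet_derivative_at[OF assms] by (simp add: partial_deriv_def)

lemma has_derivative_frechet:
  assumes "f differentiable (at x)"
  shows "(f has_derivative frechet_derivative f (at x)) (at x)"
  using assms by (simp add: frechet_derivative_works)

lemma DERIV_partial_deriv:
  fixes f :: "'a::euclidean_space \<Rightarrow> real"
  assumes "f differentiable (at (x + s *\<^sub>R i))"
  shows "((\<lambda>s. f (x + s *\<^sub>R i)) has_real_derivative partial_deriv i f (x + s *\<^sub>R i)) (at s)"
proof -
  let ?D = "frechet_derivative f (at (x + s *\<^sub>R i))"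
  have D: "(f has_derivative ?D) (at (x + s *\<^sub>R i))"
    by (rule has_derivative_frechet[OF assms])
  have "((\<lambda>s. f (x + s *\<^sub>R i)) has_derivative (\<lambda>h. ?D (h *\<^sub>R i))) (at s)"
    by (rule has_derivative_compose[where f = "\<lambda>s. x + s *\<^sub>R i" and g = f, OF _ D])
      (auto intro!: derivative_eq_intros)
  moreover have "?D (h *\<^sub>R i) = partial_deriv i f (x + s *\<^sub>R i) * h" for h
    using linear_scale[OF has_derivative_linear[OF D]] by (simp add: partial_deriv_def)
  ultimately show ?thesis by (simp add: has_field_derivative_def)
qed

lemma box_periodic_partial_deriv:
  assumes "box_periodic a b f" "\<And>x. f differentiable (at x)"
  shows "box_periodic a b (partial_deriv i f)"
  unfolding box_periodic_def
proof (intro allI ballI)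
  fix x j :: 'a assume j: "j \<in> Basis"
  define c where "c = ((b - a) \<bullet> j) *\<^sub>R j"
  have f: "(\<lambda>y. f (y + c)) = f" using assms(1) j by (auto simp: box_periodic_def c_def)
  have "((\<lambda>y. f (y + c)) has_derivative frechet_derivative f (at (x + c))) (at x)"
    by (rule has_derivative_compose[where f = "\<lambda>y. y + c" and g = f, OF _ has_derivative_frechet[OF assms(2)]])
      (auto intro!: derivative_eq_intros)
  then show "partial_deriv i f (x + c) = partial_deriv i f x"
    unfolding f by (simp add: partial_deriv_eqI) (simp add: partial_deriv_def)
qed

text \<open>The integral of \<open>f (x + s i)\<close> over the box is independent of \<open>s\<close>; differentiate in \<open>s\<close>.\<close>

lemma integral_partial_deriv_periodic:
  fixes f :: "'a::euclidean_space \<Rightarrow> real"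
  assumes diff: "\<And>x. f differentiable (at x)" and cont: "continuous_on UNIV (partial_deriv i f)"
    and per: "box_periodic a b f" and i: "i \<in> Basis" and ne: "box a b \<noteq> {}"
  shows "integral (cbox a b) (partial_deriv i f) = 0"
proof -
  define L where "L = (b - a) \<bullet> i"
  define G where "G = (\<lambda>s. integral (cbox a b) (\<lambda>x. f (x + s *\<^sub>R i)))"
  have L: "0 < L" using ne i by (simp add: L_def box_ne_empty inner_diff_left)
  have cf: "continuous_on UNIV f"
    using diff by (rule differentiable_imp_continuous_on_UNIV)
  \<comment> \<open>The shift \<open>L/2\<close> is interior to the range on which \<open>G\<close>
    is known to be constant, so the derivative there is two-sided.\<close>
  have "(G has_field_derivative integral (cbox a b) (\<lambda>x. partial_deriv i f (x + (L/2) *\<^sub>R i))) (at (L/2) within {0<..<L})"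
    unfolding G_def
  proof (rule leibniz_rule_field_derivative)
    show "((\<lambda>s. f (x + s *\<^sub>R i)) has_real_derivative partial_deriv i f (x + s *\<^sub>R i)) (at s within {0<..<L})" for s x
      by (intro DERIV_subset[OF DERIV_partial_deriv[OF diff]]) auto
    show "continuous_on ({0<..<L} \<times> cbox a b) (\<lambda>(s, x). partial_deriv i f (x + s *\<^sub>R i))"
      unfolding split_beta by (rule continuous_on_compose2[OF cont]) (auto intro!: continuous_intros)
    show "(\<lambda>x. f (x + s *\<^sub>R i)) integrable_on cbox a b" for s
      by (intro integrable_on_cbox_continuous continuous_on_compose2[OF cf]) (auto intro!: continuous_intros)
  qed (use L in auto)
  then have "(G has_real_derivative integral (cbox a b) (\<lambda>x. partial_deriv i f (x + (L/2) *\<^sub>R i))) (at (L/2))"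
    using L by (subst (asm) at_within_open) auto
  moreover have "(G has_real_derivative 0) (at (L/2))"
  proof (rule has_field_derivative_transform_within_open)
    show "integral (cbox a b) f = G s" if "s \<in> {0<..<L}" for s
      unfolding G_def using integral_cbox_periodic_shift[OF cf per i, of s] that by (simp add: L_def)
  qed (use L in auto)
  ultimately have "integral (cbox a b) (\<lambda>x. partial_deriv i f (x + (L/2) *\<^sub>R i)) = 0"
    by (rule DERIV_unique)
  then show ?thesis
    using integral_cbox_periodic_shift[OF cont box_periodic_partial_deriv[OF per diff] i, of "L/2"] L
    by (simp add: L_def)
qed

lemma partial_deriv_mult:
  fixes f g :: "'a::euclidean_space \<Rightarrow> real"
  assumes "f differentiable (at x)" "g differentiable (at x)"
  shows "partial_deriv i (\<lambda>x. f x * g x) x = partial_deriv i f x * g x + f x * partial_deriv i g x"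
  using partial_deriv_eqI[OF has_derivative_mult[OF has_derivative_frechet[OF assms(1)] has_derivative_frechet[OF assms(2)]]]
  by (simp add: partial_deriv_def)

lemma partial_deriv_combination:
  fixes f g :: "'a::euclidean_space \<Rightarrow> real"
  assumes "f differentiable (at x)" "g differentiable (at x)"
  shows "partial_deriv i (\<lambda>x. c * f x + d * g x) x = c * partial_deriv i f x + d * partial_deriv i g x"
  using partial_deriv_eqI[OF has_derivative_add[OF
      has_derivative_mult_right[OF has_derivative_frechet[OF assms(1)], of c]
      has_derivative_mult_right[OF has_derivative_frechet[OF assms(2)], of d]]]
  by (simp add: partial_deriv_def)

lemma C_diff_2_iff:
  fixes f :: "'a::euclidean_space \<Rightarrow> real"
  shows "C_diff 2 f \<longleftrightarrow> (\<forall>x. f differentiable (at x)) \<and>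
     (\<forall>i\<in>Basis. (\<forall>x. partial_deriv i f differentiable (at x)) \<and>
        (\<forall>j\<in>Basis. continuous_on UNIV (partial_deriv j (partial_deriv i f))))"
  by (simp add: numeral_2_eq_2)

lemma C_diff_2_combination:
  fixes f g :: "'a::euclidean_space \<Rightarrow> real"
  assumes f: "C_diff 2 f" and g: "C_diff 2 g"
  shows "C_diff 2 (\<lambda>x. c * f x + d * g x)"
proof -
  have d: "\<And>x. f differentiable (at x)" "\<And>x. g differentiable (at x)"
    "\<And>i x. i \<in> Basis \<Longrightarrow> partial_deriv i f differentiable (at x)"
    "\<And>i x. i \<in> Basis \<Longrightarrow> partial_deriv i g differentiable (at x)"
    using f g by (auto simp: C_diff_2_iff)
  have 1: "partial_deriv i (\<lambda>x. c * f x + d * g x) = (\<lambda>x. c * partial_deriv i f x + d * partial_deriv i g x)" for i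
    by (intro ext partial_deriv_combination d)
  have 2: "partial_deriv j (\<lambda>x. c * partial_deriv i f x + d * partial_deriv i g x) =
      (\<lambda>x. c * partial_deriv j (partial_deriv i f) x + d * partial_deriv j (partial_deriv i g) x)" if "i \<in> Basis" for i j
    using that by (intro ext partial_deriv_combination d)
  show ?thesis
    unfolding C_diff_2_iff 1 using f g
    by (auto simp: 2 C_diff_2_iff intro!: derivative_intros continuous_intros)
qed

lemma grad_inner_grad:
  "grad f x \<bullet> grad g x = (\<Sum>i\<in>Basis. partial_deriv i f x * partial_deriv i g x)"
  unfolding grad_def by (simp add: inner_sum_left inner_sum_right inner_Basis if_distrib sum.If_cases mult.commute cong: if_cong)

text \<open>In each coordinate the derivative of \<open>partial_deriv i f * g\<close> integrates to
  zero by periodicity; the product rule and summation over the basis do the rest.\<close>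

lemma integral_laplacian_mult:
  fixes f g :: "'a::euclidean_space \<Rightarrow> real"
  assumes f: "C_diff 2 f" "box_periodic a b f" and g: "C_diff 2 g" "box_periodic a b g"
    and ne: "box a b \<noteq> {}"
  shows "integral (cbox a b) (\<lambda>x. laplacian f x * g x) = - integral (cbox a b) (\<lambda>x. grad f x \<bullet> grad g x)"
proof -
  have d: "\<And>x. f differentiable (at x)" "\<And>x. g differentiable (at x)"
    "\<And>i x. i \<in> Basis \<Longrightarrow> partial_deriv i f differentiable (at x)"
    "\<And>i x. i \<in> Basis \<Longrightarrow> partial_deriv i g differentiable (at x)"
    "\<And>i. i \<in> Basis \<Longrightarrow> continuous_on UNIV (partial_deriv i (partial_deriv i f))"
    using f g by (auto simp: C_diff_2_iff)
  note c = d(1,2,3,4)[THEN differentiable_imp_continuous_on_UNIV]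
  have eq: "partial_deriv i (\<lambda>x. partial_deriv i f x * g x) =
      (\<lambda>x. partial_deriv i (partial_deriv i f) x * g x + partial_deriv i f x * partial_deriv i g x)" if "i \<in> Basis" for i
    using that by (intro ext partial_deriv_mult d)
  have z: "integral (cbox a b) (\<lambda>x. partial_deriv i (partial_deriv i f) x * g x + partial_deriv i f x * partial_deriv i g x) = 0"
    if i: "i \<in> Basis" for i
    unfolding eq[OF i, symmetric]
  proof (rule integral_partial_deriv_periodic[OF _ _ _ i ne])
    show "(\<lambda>x. partial_deriv i f x * g x) differentiable (at x)" for x
      using i by (intro differentiable_mult d)
    show "continuous_on UNIV (partial_deriv i (\<lambda>x. partial_deriv i f x * g x))"
      unfolding eq[OF i] using i by (intro continuous_intros c d)
    show "box_periodic a b (\<lambda>x. partial_deriv i f x * g x)"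
      using box_periodic_partial_deriv[OF f(2) d(1)] g(2) by (simp add: box_periodic_def)
  qed
  have int: "(\<lambda>x. partial_deriv i (partial_deriv i f) x * g x + partial_deriv i f x * partial_deriv i g x) integrable_on cbox a b"
    if "i \<in> Basis" for i
    using that by (intro integrable_on_cbox_continuous continuous_intros c d)
  have lap: "continuous_on UNIV (\<lambda>x. laplacian f x * g x)"
    unfolding laplacian_def by (intro continuous_intros c d)
  have gr: "continuous_on UNIV (\<lambda>x. grad f x \<bullet> grad g x)"
    unfolding grad_inner_grad by (intro continuous_intros c)
  have "integral (cbox a b) (\<lambda>x. laplacian f x * g x) + integral (cbox a b) (\<lambda>x. grad f x \<bullet> grad g x)
      = integral (cbox a b) (\<lambda>x. laplacian f x * g x + grad f x \<bullet> grad g x)"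
    using lap gr by (intro integral_add[symmetric] integrable_on_cbox_continuous)
  also have "(\<lambda>x. laplacian f x * g x + grad f x \<bullet> grad g x) = (\<lambda>x. \<Sum>i\<in>Basis.
      partial_deriv i (partial_deriv i f) x * g x + partial_deriv i f x * partial_deriv i g x)"
    by (simp add: laplacian_def grad_inner_grad sum.distrib sum_distrib_right)
  also have "integral (cbox a b) \<dots> = 0"
    using int z by (subst integral_sum) auto
  finally show ?thesis by simp
qed

section \<open>Energy increments\<close>

text \<open>Abel summation against the tails \<open>S k\<close>, with
  \<open>(S k + v)^2 - (S k)^2 = v (2 S k + v)\<close> for the newest increment \<open>v\<close>.
  The term \<open>- 1/2 * \<kappa> n * w n\<close> undoes the doubling of the diagonal
  entry.\<close>

lemma sum_by_parts_squares:
  fixes w :: "nat \<Rightarrow> real" and \<kappa> :: "nat \<Rightarrow> real" and n :: nat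
  assumes "1 \<le> n"
  shows "w n * ((\<Sum>j=1..n. \<kappa> j * w j) - 1/2 * \<kappa> n * w n) =
    1/2 * (\<Sum>k=1..n-1. (\<kappa> (k + 1) - \<kappa> k) * ((\<Sum>j=k+1..n. w j)\<^sup>2 - (\<Sum>j=k+1..n-1. w j)\<^sup>2))
    + 1/2 * \<kappa> 1 * ((\<Sum>j=1..n. w j)\<^sup>2 - (\<Sum>j=1..n-1. w j)\<^sup>2)"
proof -
  obtain m where m: "n = Suc m" using assms by (cases n) auto
  define S where "S = (\<lambda>k. \<Sum>j=k+1..m. w j)"
  define v where "v = w (Suc m)"
  have S1: "(\<Sum>j=k+1..n. w j) = S k + v" if "k \<le> m" for k
    using that by (simp add: m S_def v_def)
  have sq: "(S k + v)\<^sup>2 - (S k)\<^sup>2 = v * (2 * S k + v)" for k by (simp add: power2_eq_square algebra_simps)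
  \<comment> \<open>Each partial sum carries a boundary term in the current tail; at
    \<open>l = m\<close> that tail is empty and only the newest increment is left.\<close>
  have abel: "(\<Sum>k=1..l. (\<kappa> (k + 1) - \<kappa> k) * (2 * (\<Sum>j=k+1..m. w j) + v)) + \<kappa> 1 * (2 * (\<Sum>j=1..m. w j) + v)
     = 2 * (\<Sum>j=1..l. \<kappa> j * w j) + \<kappa> (l + 1) * (2 * (\<Sum>j=l+1..m. w j) + v)" if "l \<le> m" for l
    using that
  proof (induction l)
    case (Suc l)
    have "(\<Sum>j=l+1..m. w j) = w (Suc l) + (\<Sum>j=Suc l+1..m. w j)"
      using Suc.prems by (simp add: sum.atLeast_Suc_atMost)
    then show ?case using Suc by (simp add: algebra_simps)
  qed simp
  have "1/2 * (\<Sum>k=1..n-1. (\<kappa> (k + 1) - \<kappa> k) * ((\<Sum>j=k+1..n. w j)\<^sup>2 - (\<Sum>j=k+1..n-1. w j)\<^sup>2))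
      + 1/2 * \<kappa> 1 * ((\<Sum>j=1..n. w j)\<^sup>2 - (\<Sum>j=1..n-1. w j)\<^sup>2)
    = v / 2 * ((\<Sum>k=1..m. (\<kappa> (k + 1) - \<kappa> k) * (2 * S k + v)) + \<kappa> 1 * (2 * S 0 + v))"
  proof -
    have "(\<Sum>k=1..n-1. (\<kappa> (k + 1) - \<kappa> k) * ((\<Sum>j=k+1..n. w j)\<^sup>2 - (\<Sum>j=k+1..n-1. w j)\<^sup>2)) =
       (\<Sum>k=1..m. v * ((\<kappa> (k + 1) - \<kappa> k) * (2 * S k + v)))"
    proof (intro sum.cong)
      fix k assume "k \<in> {1..m}"
      then show "(\<kappa> (k + 1) - \<kappa> k) * ((\<Sum>j=k+1..n. w j)\<^sup>2 - (\<Sum>j=k+1..n-1. w j)\<^sup>2)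
          = v * ((\<kappa> (k + 1) - \<kappa> k) * (2 * S k + v))"
        using S1[of k] sq[of k] by (simp add: m S_def)
    qed (simp add: m)
    moreover have "(\<Sum>j=1..n. w j)\<^sup>2 - (\<Sum>j=1..n-1. w j)\<^sup>2 = v * (2 * S 0 + v)"
      using S1[of 0] sq[of 0] by (simp add: m S_def)
    ultimately show ?thesis
      unfolding sum_distrib_left[symmetric] by (simp add: algebra_simps)
  qed
  also have "\<dots> = v / 2 * (2 * (\<Sum>j=1..m. \<kappa> j * w j) + \<kappa> (m + 1) * v)"
    using abel[of m] by (simp add: S_def)
  also have "\<dots> = w n * ((\<Sum>j=1..n. \<kappa> j * w j) - 1/2 * \<kappa> n * w n)"
    by (simp add: m v_def algebra_simps)
  finally show ?thesis by simp
qed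

text \<open>The brackets are the integrands of \<open>A_fun\<close> at \<open>n\<close> and
  \<open>n - 1\<close> and of \<open>R_fun\<close> at \<open>n\<close>. Summation by parts yields
  the old tails with coefficients of row \<open>n\<close>, while \<open>A_fun\<close> at
  \<open>n - 1\<close> has those of row \<open>n - 1\<close>; \<open>R_fun\<close> collects the
  mismatch.\<close>

lemma kernel_quadratic_identity:
  fixes w :: "nat \<Rightarrow> real"
  assumes n: "2 \<le> n"
  shows "w n * (\<Sum>k=1..n. kernel_b t \<beta> n (n - k) * w k) =
     (1/2 * (\<Sum>k=1..n-1. (kernel_b_mod t \<beta> n (n - k - 1) - kernel_b_mod t \<beta> n (n - k)) * (\<Sum>j=k+1..n. w j)\<^sup>2)
       + 1/2 * kernel_b_mod t \<beta> n (n - 1) * (\<Sum>j=1..n. w j)\<^sup>2)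
   - (1/2 * (\<Sum>k=1..n-1-1. (kernel_b_mod t \<beta> (n - 1) (n - 1 - k - 1) - kernel_b_mod t \<beta> (n - 1) (n - 1 - k)) * (\<Sum>j=k+1..n-1. w j)\<^sup>2)
       + 1/2 * kernel_b_mod t \<beta> (n - 1) (n - 1 - 1) * (\<Sum>j=1..n-1. w j)\<^sup>2)
   + (1/2 * (\<Sum>k=1..n-2. (kernel_b_mod t \<beta> (n - 1) (n - 2 - k) - kernel_b_mod t \<beta> (n - 1) (n - 1 - k)
           - kernel_b_mod t \<beta> n (n - 1 - k) + kernel_b_mod t \<beta> n (n - k)) * (\<Sum>j=k+1..n-1. w j)\<^sup>2)
       + 1/2 * (kernel_b_mod t \<beta> (n - 1) (n - 2) - kernel_b_mod t \<beta> n (n - 1)) * (\<Sum>j=1..n-1. w j)\<^sup>2)"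
proof -
  obtain m where m: "n = Suc (Suc m)" using n by (metis add_2_eq_Suc le_Suc_ex)
  define \<kappa> where "\<kappa> = (\<lambda>k. kernel_b_mod t \<beta> n (n - k))"
  define q where "q = (\<lambda>k. (\<Sum>j=k+1..n-1. w j)\<^sup>2)"
  define Q where "Q = (\<lambda>k. (\<Sum>j=k+1..n. w j)\<^sup>2)"
  define A where "A = (\<lambda>k. kernel_b_mod t \<beta> (n - 1) (n - 2 - k) - kernel_b_mod t \<beta> (n - 1) (n - 1 - k))"
  have "(\<Sum>k=1..n. kernel_b t \<beta> n (n - k) * w k) = (\<Sum>j=1..n. \<kappa> j * w j) - 1/2 * \<kappa> n * w n"
    by (simp add: m \<kappa>_def kernel_b_mod_def Suc_diff_le)
  then have "w n * (\<Sum>k=1..n. kernel_b t \<beta> n (n - k) * w k) =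
      1/2 * (\<Sum>k=1..n-1. (\<kappa> (k + 1) - \<kappa> k) * (Q k - q k)) + 1/2 * \<kappa> 1 * (Q 0 - q 0)"
    using sum_by_parts_squares[of n w \<kappa>] n by (simp add: Q_def q_def)
  moreover have "(\<Sum>k=1..n-1. (\<kappa> (k + 1) - \<kappa> k) * (Q k - q k)) =
      (\<Sum>k=1..n-1. (\<kappa> (k + 1) - \<kappa> k) * Q k) - (\<Sum>k=1..n-2. (\<kappa> (k + 1) - \<kappa> k) * q k)"
  proof -
    \<comment> \<open>For \<open>k = n - 1\<close> the old tail is an empty sum.\<close>
    have "(\<Sum>k=1..n-1. (\<kappa> (k + 1) - \<kappa> k) * q k) = (\<Sum>k=1..n-2. (\<kappa> (k + 1) - \<kappa> k) * q k)"
      by (simp add: m q_def)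
    then show ?thesis by (simp add: right_diff_distrib sum_subtractf)
  qed
  moreover have "(\<Sum>k=1..n-1. (kernel_b_mod t \<beta> n (n - k - 1) - kernel_b_mod t \<beta> n (n - k)) * (\<Sum>j=k+1..n. w j)\<^sup>2)
      = (\<Sum>k=1..n-1. (\<kappa> (k + 1) - \<kappa> k) * Q k)"
    by (simp add: \<kappa>_def Q_def)
  moreover have "(\<Sum>k=1..n-1-1. (kernel_b_mod t \<beta> (n - 1) (n - 1 - k - 1) - kernel_b_mod t \<beta> (n - 1) (n - 1 - k)) * (\<Sum>j=k+1..n-1. w j)\<^sup>2)
      = (\<Sum>k=1..n-2. A k * q k)"
    by (simp add: m A_def q_def)
  moreover have "(\<Sum>k=1..n-2. (kernel_b_mod t \<beta> (n - 1) (n - 2 - k) - kernel_b_mod t \<beta> (n - 1) (n - 1 - k)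
           - kernel_b_mod t \<beta> n (n - 1 - k) + kernel_b_mod t \<beta> n (n - k)) * (\<Sum>j=k+1..n-1. w j)\<^sup>2)
      = (\<Sum>k=1..n-2. A k * q k) - (\<Sum>k=1..n-2. (\<kappa> (k + 1) - \<kappa> k) * q k)"
    unfolding sum_subtractf[symmetric]
    by (intro sum.cong refl) (simp add: m A_def \<kappa>_def q_def algebra_simps)
  ultimately show ?thesis
    by (simp add: \<kappa>_def Q_def q_def m algebra_simps)
qed

text \<open>Average times increment is half a difference of squares, both for the function and,
  after Green's formula, for the gradient.\<close>

lemma relaxed_energy_step:
  fixes P Q R R' \<mu> :: "'a::euclidean_space \<Rightarrow> real"
  assumes P: "C_diff 2 P" "box_periodic a b P" and Q: "C_diff 2 Q" "box_periodic a b Q"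
    and R: "continuous_on UNIV R" "continuous_on UNIV R'"
    and ne: "box a b \<noteq> {}"
    and \<mu>: "\<And>x. x \<in> box a b \<Longrightarrow>
      \<mu> x = - \<epsilon>\<^sup>2 * laplacian (\<lambda>x. (Q x + P x) / 2) x + (R' x + S) * ((Q x + P x) / 2)"
    and r: "\<And>x. x \<in> box a b \<Longrightarrow> (R' x + R x) / 2 = (P x)\<^sup>2 - 1 - S"
  shows "relaxed_energy (box a b) \<epsilon> S Q R' - relaxed_energy (box a b) \<epsilon> S P R
    = integral (cbox a b) (\<lambda>x. \<mu> x * (Q x - P x))"
proof -
  define f where "f = (\<lambda>x. (1/2) * Q x + (1/2) * P x)"
  define w where "w = (\<lambda>x. 1 * Q x + (-1) * P x)"
  have f: "C_diff 2 f" "box_periodic a b f" and w: "C_diff 2 w" "box_periodic a b w"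
    using C_diff_2_combination[OF Q(1) P(1)] P(2) Q(2) unfolding f_def w_def
    by (blast, simp add: box_periodic_def)+
  have d: "\<And>x. P differentiable (at x)" "\<And>x. Q differentiable (at x)"
    "\<And>x. f differentiable (at x)" "\<And>x. w differentiable (at x)"
    "\<And>i x. i \<in> Basis \<Longrightarrow> partial_deriv i P differentiable (at x)"
    "\<And>i x. i \<in> Basis \<Longrightarrow> partial_deriv i Q differentiable (at x)"
    "\<And>i x. i \<in> Basis \<Longrightarrow> partial_deriv i f differentiable (at x)"
    "\<And>i x. i \<in> Basis \<Longrightarrow> partial_deriv i w differentiable (at x)"
    "\<And>i. i \<in> Basis \<Longrightarrow> continuous_on UNIV (partial_deriv i (partial_deriv i f))"
    using P Q f w by (auto simp: C_diff_2_iff)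
  note c = d(1-8)[THEN differentiable_imp_continuous_on_UNIV] d(9)
  have ng: "(norm (grad g x))\<^sup>2 = (\<Sum>i\<in>Basis. partial_deriv i g x * partial_deriv i g x)" for g :: "'a \<Rightarrow> real" and x
    unfolding dot_square_norm[symmetric] grad_inner_grad ..
  have cg: "continuous_on UNIV (\<lambda>x. (norm (grad P x))\<^sup>2)" "continuous_on UNIV (\<lambda>x. (norm (grad Q x))\<^sup>2)"
    "continuous_on UNIV (\<lambda>x. grad f x \<bullet> grad w x)" "continuous_on UNIV (laplacian f)"
    unfolding ng grad_inner_grad laplacian_def by (intro continuous_intros c; assumption)+
  have grad: "grad f x \<bullet> grad w x = 1/2 * ((norm (grad Q x))\<^sup>2 - (norm (grad P x))\<^sup>2)" for x
    unfolding ng grad_inner_grad f_def w_def partial_deriv_combination[OF d(2,1)]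
    unfolding sum_subtractf[symmetric] sum_distrib_left
    by (intro sum.cong refl) (simp add: algebra_simps)
  have "relaxed_energy (box a b) \<epsilon> S Q R' - relaxed_energy (box a b) \<epsilon> S P R =
     integral (cbox a b) (\<lambda>x. \<epsilon>\<^sup>2 / 2 * (norm (grad Q x))\<^sup>2 + 1/2 * (R' x + S) * ((Q x)\<^sup>2 - 1 - S) - 1/4 * (R' x)\<^sup>2)
     - integral (cbox a b) (\<lambda>x. \<epsilon>\<^sup>2 / 2 * (norm (grad P x))\<^sup>2 + 1/2 * (R x + S) * ((P x)\<^sup>2 - 1 - S) - 1/4 * (R x)\<^sup>2)"
    unfolding relaxed_energy_def
    by (subst (1 2) LINT_box_eq_integral) (auto intro!: continuous_intros cg c R)
  also have "\<dots> = integral (cbox a b) (\<lambda>x.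
       (\<epsilon>\<^sup>2 / 2 * (norm (grad Q x))\<^sup>2 + 1/2 * (R' x + S) * ((Q x)\<^sup>2 - 1 - S) - 1/4 * (R' x)\<^sup>2)
     - (\<epsilon>\<^sup>2 / 2 * (norm (grad P x))\<^sup>2 + 1/2 * (R x + S) * ((P x)\<^sup>2 - 1 - S) - 1/4 * (R x)\<^sup>2))"
    by (intro integral_diff[symmetric] integrable_on_cbox_continuous continuous_intros cg c R)
  also have "\<dots> = integral (cbox a b) (\<lambda>x. \<epsilon>\<^sup>2 * (grad f x \<bullet> grad w x) + (R' x + S) * f x * w x)"
  proof (rule integral_cbox_cong_box)
    fix x assume "x \<in> box a b"
    \<comment> \<open>With this substitution, replacing \<open>R + S\<close> by
      \<open>R' + S\<close> in the old energy costs \<open>(R' - R)(R' + R)/4\<close>, which cancels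
      the change of the quarter square of the relaxation variable.\<close>
    then have Px: "(P x)\<^sup>2 = (R' x + R x) / 2 + 1 + S" using r[of x] by linarith
    have fw: "f x * w x = 1/2 * ((Q x)\<^sup>2 - (P x)\<^sup>2)"
      by (simp add: f_def w_def power2_eq_square field_simps)
    then show "(\<epsilon>\<^sup>2 / 2 * (norm (grad Q x))\<^sup>2 + 1/2 * (R' x + S) * ((Q x)\<^sup>2 - 1 - S) - 1/4 * (R' x)\<^sup>2)
     - (\<epsilon>\<^sup>2 / 2 * (norm (grad P x))\<^sup>2 + 1/2 * (R x + S) * ((P x)\<^sup>2 - 1 - S) - 1/4 * (R x)\<^sup>2) =
       \<epsilon>\<^sup>2 * (grad f x \<bullet> grad w x) + (R' x + S) * f x * w x"
      unfolding grad mult.assoc[of _ "f x"] fw Px by (simp add: power2_eq_square field_simps)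
  qed
  also have "\<dots> = \<epsilon>\<^sup>2 * integral (cbox a b) (\<lambda>x. grad f x \<bullet> grad w x) + integral (cbox a b) (\<lambda>x. (R' x + S) * f x * w x)"
    by (subst integral_add) (auto intro!: integrable_on_cbox_continuous continuous_intros cg c R)
  also have "\<dots> = - \<epsilon>\<^sup>2 * integral (cbox a b) (\<lambda>x. laplacian f x * w x) + integral (cbox a b) (\<lambda>x. (R' x + S) * f x * w x)"
    using integral_laplacian_mult[OF f w ne] by simp
  also have "\<dots> = integral (cbox a b) (\<lambda>x. - \<epsilon>\<^sup>2 * (laplacian f x * w x) + (R' x + S) * f x * w x)"
    by (subst integral_add) (auto intro!: integrable_on_cbox_continuous continuous_intros cg c R)
  also have "\<dots> = integral (cbox a b) (\<lambda>x. \<mu> x * (Q x - P x))"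
  proof (rule integral_cbox_cong_box)
    have avg: "(\<lambda>x. (Q x + P x) / 2) = f" by (simp add: f_def fun_eq_iff add_divide_distrib)
    show "- \<epsilon>\<^sup>2 * (laplacian f x * w x) + (R' x + S) * f x * w x = \<mu> x * (Q x - P x)" if "x \<in> box a b" for x
    proof -
      have "\<mu> x = - \<epsilon>\<^sup>2 * laplacian f x + (R' x + S) * f x"
        using \<mu>[OF that] unfolding avg fun_cong[OF avg] .
      moreover have "Q x - P x = w x" by (simp add: w_def)
      ultimately show ?thesis by algebra
    qed
  qed
  finally show ?thesis .
qed

text \<open>This is the diagonal coefficient in the induction that derives mass
  conservation.\<close>

lemma kernel_b_0_pos:
  fixes t :: "nat \<Rightarrow> real"
  assumes b: "0 < \<beta>" "\<beta> < 1" and n: "1 \<le> n"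
    and mono: "\<And>i j. i < j \<Longrightarrow> j \<le> n \<Longrightarrow> t i < t j"
  shows "0 < kernel_b t \<beta> n 0"
proof -
  have \<tau>: "0 < time_step t n" using mono[of "n - 1" n] n by (simp add: time_step_def)
  have "kernel_b_mod t \<beta> n (n - n) =
     power_second_diff (1 + \<beta>) t n n / (time_step t n * time_step t n * (\<beta> * (1 + \<beta>) * Gamma \<beta>))"
    using b n mono by (intro kernel_b_mod_eq) auto
  also have "\<dots> > 0"
    using \<tau> b by (intro divide_pos_pos mult_pos_pos Gamma_real_pos)
      (auto simp: power_second_diff_def time_step_def intro!: add_pos_pos)
  finally show ?thesis by (simp add: kernel_b_mod_def)
qed

lemma mean_value_eq:
  fixes f :: "'a::euclidean_space \<Rightarrow> real"
  assumes "continuous_on UNIV f"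
  shows "mean_value (box a b) f = integral (cbox a b) f / measure lborel (box a b)"
  using assms by (simp add: mean_value_def L2_inner_def LINT_box_eq_integral)

lemma measure_box_pos:
  fixes a b :: "'a::euclidean_space"
  shows "box a b \<noteq> {} \<Longrightarrow> 0 < measure lborel (box a b)"
  by (auto simp: measure_lborel_box_eq box_ne_empty inner_diff_left intro!: prod_pos)

lemma integral_minus_mean_value:
  fixes f :: "'a::euclidean_space \<Rightarrow> real"
  assumes f: "continuous_on UNIV f" and ne: "box a b \<noteq> {}"
  shows "integral (cbox a b) (\<lambda>x. f x - mean_value (box a b) f) = 0"
proof -
  have "integral (cbox a b) (\<lambda>x. f x - mean_value (box a b) f) =
      integral (cbox a b) f - measure lborel (cbox a b) * mean_value (box a b) f"
    using f by (subst integral_diff) (auto intro!: integrable_on_cbox_continuous)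
  also have "measure lborel (cbox a b) = measure lborel (box a b)"
    by (simp add: measure_lborel_box_eq measure_lborel_cbox_eq)
  finally show ?thesis using measure_box_pos[OF ne] f by (simp add: mean_value_eq)
qed

lemma L2_norm_square:
  fixes f :: "'a::euclidean_space \<Rightarrow> real"
  assumes "continuous_on UNIV f"
  shows "(L2_norm (box a b) f)\<^sup>2 = integral (cbox a b) (\<lambda>x. (f x)\<^sup>2)"
proof -
  have "L2_inner (box a b) f f = integral (cbox a b) (\<lambda>x. (f x)\<^sup>2)"
    using assms unfolding L2_inner_def power2_eq_square by (intro LINT_box_eq_integral continuous_intros)
  moreover have "0 \<le> integral (cbox a b) (\<lambda>x. (f x)\<^sup>2)"
    using assms by (intro integral_nonneg integrable_on_cbox_continuous continuous_intros) auto
  ultimately show ?thesis by (simp add: L2_norm_def)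
qed

lemma integral_sum_squares:
  fixes g :: "nat \<Rightarrow> 'a::euclidean_space \<Rightarrow> real"
  assumes "\<And>k. k \<in> I \<Longrightarrow> continuous_on UNIV (g k)" "continuous_on UNIV h"
  shows "integral (cbox a b) (\<lambda>x. 1/2 * (\<Sum>k\<in>I. c k * (g k x)\<^sup>2) + 1/2 * d * (h x)\<^sup>2) =
    1/2 * (\<Sum>k\<in>I. c k * (L2_norm (box a b) (g k))\<^sup>2) + 1/2 * d * (L2_norm (box a b) h)\<^sup>2"
proof (cases "finite I")
  case True
  have "integral (cbox a b) (\<lambda>x. 1/2 * (\<Sum>k\<in>I. c k * (g k x)\<^sup>2) + 1/2 * d * (h x)\<^sup>2) =
      1/2 * integral (cbox a b) (\<lambda>x. \<Sum>k\<in>I. c k * (g k x)\<^sup>2) + 1/2 * d * integral (cbox a b) (\<lambda>x. (h x)\<^sup>2)"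
    using assms by (subst integral_add) (auto intro!: integrable_on_cbox_continuous continuous_intros)
  also have "integral (cbox a b) (\<lambda>x. \<Sum>k\<in>I. c k * (g k x)\<^sup>2) = (\<Sum>k\<in>I. c k * integral (cbox a b) (\<lambda>x. (g k x)\<^sup>2))"
    using assms True by (subst integral_sum) (auto intro!: integrable_on_cbox_continuous continuous_intros)
  finally show ?thesis using assms by (simp add: L2_norm_square)
next
  case False
  then show ?thesis using assms by (simp add: L2_norm_square)
qed

lemma integral_backward_diff_caputo:
  fixes \<phi> :: "nat \<Rightarrow> 'a::euclidean_space \<Rightarrow> real"
  assumes n: "1 \<le> n" and cont: "\<And>k. k \<le> n + 1 \<Longrightarrow> continuous_on UNIV (\<phi> k)"
  shows "integral (cbox a b) (\<lambda>x. backward_diff \<phi> (n + 1) x * caputo_L1plus t \<alpha> \<phi> n x) =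
    A_fun (box a b) t (1 - \<alpha>) (backward_diff \<phi>) (n + 1) - A_fun (box a b) t (1 - \<alpha>) (backward_diff \<phi>) n
    + R_fun (box a b) t (1 - \<alpha>) (backward_diff \<phi>) (n + 1)"
proof -
  define w where "w = backward_diff \<phi>"
  have w: "continuous_on UNIV (w k)" if "k \<le> n + 1" for k
    unfolding w_def backward_diff_def using that by (intro continuous_intros cont) auto
  define fA where "fA = (\<lambda>n x. 1/2 * (\<Sum>k=1..n-1. (kernel_b_mod t (1 - \<alpha>) n (n - k - 1) - kernel_b_mod t (1 - \<alpha>) n (n - k)) *
       (\<Sum>j=k+1..n. w j x)\<^sup>2) + 1/2 * kernel_b_mod t (1 - \<alpha>) n (n - 1) * (\<Sum>j=1..n. w j x)\<^sup>2)"
  define fR where "fR = (\<lambda>n x. 1/2 * (\<Sum>k=1..n-2. (kernel_b_mod t (1 - \<alpha>) (n - 1) (n - 2 - k) - kernel_b_mod t (1 - \<alpha>) (n - 1) (n - 1 - k)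
           - kernel_b_mod t (1 - \<alpha>) n (n - 1 - k) + kernel_b_mod t (1 - \<alpha>) n (n - k)) * (\<Sum>j=k+1..n-1. w j x)\<^sup>2)
       + 1/2 * (kernel_b_mod t (1 - \<alpha>) (n - 1) (n - 2) - kernel_b_mod t (1 - \<alpha>) n (n - 1)) * (\<Sum>j=1..n-1. w j x)\<^sup>2)"
  have cs: "continuous_on UNIV (\<lambda>x. \<Sum>j=k..m. w j x)" if "m \<le> n + 1" for k m
    using that by (intro continuous_intros w) auto
  have A: "A_fun (box a b) t (1 - \<alpha>) w m = integral (cbox a b) (fA m)" if "m \<le> n + 1" for m
    unfolding A_fun_def fA_def using that by (intro integral_sum_squares[symmetric] cs)
  have R: "R_fun (box a b) t (1 - \<alpha>) w (n + 1) = integral (cbox a b) (fR (n + 1))"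
    unfolding R_fun_def fR_def by (intro integral_sum_squares[symmetric] cs) auto
  have cA: "continuous_on UNIV (fA m)" if "m \<le> n + 1" for m
    unfolding fA_def using that by (intro continuous_intros cs)
  have cR: "continuous_on UNIV (fR (n + 1))"
    unfolding fR_def by (intro continuous_intros cs) auto
  have "w (n + 1) x * caputo_L1plus t \<alpha> \<phi> n x = fA (n + 1) x - fA n x + fR (n + 1) x" for x
    using kernel_quadratic_identity[of "n + 1" "\<lambda>k. w k x" t "1 - \<alpha>"] n
    by (simp add: caputo_L1plus_def w_def[symmetric] fA_def fR_def)
  then have "integral (cbox a b) (\<lambda>x. w (n + 1) x * caputo_L1plus t \<alpha> \<phi> n x) =
      integral (cbox a b) (\<lambda>x. fA (n + 1) x - fA n x + fR (n + 1) x)" by simp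
  also have "\<dots> = integral (cbox a b) (\<lambda>x. fA (n + 1) x - fA n x) + integral (cbox a b) (fR (n + 1))"
    by (intro integral_add integrable_on_cbox_continuous continuous_intros cA cR) auto
  also have "integral (cbox a b) (\<lambda>x. fA (n + 1) x - fA n x) = integral (cbox a b) (fA (n + 1)) - integral (cbox a b) (fA n)"
    by (intro integral_diff integrable_on_cbox_continuous cA) auto
  finally show ?thesis using A R by (simp add: w_def)
qed

text \<open>All coefficients are nonnegative: the summand \<open>k = n - 1\<close> by the
  adjacent-step bound, earlier ones by convexity, the separate last term by monotonicity in column
  1.\<close>

lemma R_fun_nonneg:
  fixes t :: "nat \<Rightarrow> real"
  assumes b: "0 < \<beta>" "\<beta> < 1" and n: "2 \<le> n"
    and mono: "\<And>i j. i < j \<Longrightarrow> j \<le> n + 1 \<Longrightarrow> t i < t j"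
    and ratio: "H_fun \<beta> (step_ratio t n) \<le> step_ratio t (n + 1)"
  shows "0 \<le> R_fun \<Omega> t \<beta> u (n + 1)"
proof -
  have "0 \<le> kernel_b_mod t \<beta> n (n - (k + 1)) - kernel_b_mod t \<beta> n (n - k)
     - kernel_b_mod t \<beta> (n + 1) (n + 1 - (k + 1)) + kernel_b_mod t \<beta> (n + 1) (n + 1 - k)"
    if k: "k \<in> {1..n-1}" for k
  proof (cases "k = n - 1")
    case True
    then have "k + 1 = n" using n by simp
    then show ?thesis using kernel_b_mod_mixed_diff_near[OF b n mono ratio] True by simp
  next
    case False
    then have "1 \<le> k" "k + 1 < n" using k by auto
    then show ?thesis by (rule kernel_b_mod_mixed_diff_far[OF b _ _ mono])
  qed
  then have "0 \<le> 1/2 * (\<Sum>k=1..n+1-2. (kernel_b_mod t \<beta> (n + 1 - 1) (n + 1 - 2 - k) - kernel_b_mod t \<beta> (n + 1 - 1) (n + 1 - 1 - k)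
       - kernel_b_mod t \<beta> (n + 1) (n + 1 - 1 - k) + kernel_b_mod t \<beta> (n + 1) (n + 1 - k)) *
       (L2_norm \<Omega> (\<lambda>x. \<Sum>j=k+1..n+1-1. u j x))\<^sup>2)"
    by (intro mult_nonneg_nonneg[of "1/2"] sum_nonneg mult_nonneg_nonneg[OF _ zero_le_power2]) auto
  moreover have "kernel_b_mod t \<beta> (n + 1) (n + 1 - 1) \<le> kernel_b_mod t \<beta> n (n - 1)"
    using n by (intro kernel_b_mod_column_antimono b mono) auto
  then have "0 \<le> 1/2 * (kernel_b_mod t \<beta> (n + 1 - 1) (n + 1 - 2) - kernel_b_mod t \<beta> (n + 1) (n + 1 - 1)) *
       (L2_norm \<Omega> (\<lambda>x. \<Sum>j=1..n+1-1. u j x))\<^sup>2"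
    by (intro mult_nonneg_nonneg zero_le_power2) auto
  ultimately show ?thesis
    unfolding R_fun_def by (rule add_nonneg_nonneg)
qed


section \<open>Energy balance of the scheme\<close>

text \<open>The first equation of the scheme expresses \<open>\<mu>\<close> minus its mean by the
  Caputo derivative; the mean is constant in space and multiplies an increment of zero
  integral.\<close>

lemma scheme_energy_step:
  fixes \<phi> r \<mu> :: "nat \<Rightarrow> 'a::euclidean_space \<Rightarrow> real"
  assumes domain: "box a b \<noteq> {}" and alpha: "0 < \<alpha>" "\<alpha> < 1" and M: "M > 0"
    and mono: "\<And>i j. i < j \<Longrightarrow> j \<le> N \<Longrightarrow> t i < t j"
    and scheme: "L1plus_CN_relaxation a b \<alpha> M \<epsilon> S t N \<phi> r \<mu>"
    and n: "n < N"
  shows "relaxed_energy (box a b) \<epsilon> S (\<phi> (n + 1)) (r (n + 1)) - relaxed_energy (box a b) \<epsilon> S (\<phi> n) (r n)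
    = - (1 / M) * integral (cbox a b) (\<lambda>x. backward_diff \<phi> (n + 1) x * caputo_L1plus t \<alpha> \<phi> n x)"
proof -
  note sch = scheme[unfolded L1plus_CN_relaxation_def]
  define w where "w = backward_diff \<phi>"
  have \<phi>: "box_periodic a b (\<phi> k)" "C_diff 2 (\<phi> k)" "continuous_on UNIV (r k)" if "k \<le> N" for k
    using sch that by auto
  have c\<phi>: "continuous_on UNIV (\<phi> k)" if "k \<le> N" for k
    using \<phi>(2)[OF that] by (intro differentiable_imp_continuous_on_UNIV) (simp add: C_diff_2_iff)
  have c\<mu>: "continuous_on UNIV (\<mu> k)" if "k < N" for k using sch that by auto
  have cw: "continuous_on UNIV (w k)" if "k \<le> N" for k
    unfolding w_def backward_diff_def using that by (intro continuous_intros c\<phi>) auto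
  have caputo: "caputo_L1plus t \<alpha> \<phi> k x = - M * (\<mu> k x - mean_value (box a b) (\<mu> k))"
    if "k < N" "x \<in> box a b" for k x
    using sch that by blast
  have ccap: "continuous_on UNIV (caputo_L1plus t \<alpha> \<phi> k)" if "k < N" for k
    unfolding caputo_L1plus_def w_def[symmetric] using that by (intro continuous_intros cw) auto
  have cap0: "integral (cbox a b) (caputo_L1plus t \<alpha> \<phi> k) = 0" if k: "k < N" for k
  proof -
    have "integral (cbox a b) (caputo_L1plus t \<alpha> \<phi> k) =
        integral (cbox a b) (\<lambda>x. - M * (\<mu> k x - mean_value (box a b) (\<mu> k)))"
      using caputo[OF k] by (rule integral_cbox_cong_box)
    also have "\<dots> = - M * integral (cbox a b) (\<lambda>x. \<mu> k x - mean_value (box a b) (\<mu> k))"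
      by (rule integral_mult_right)
    finally show ?thesis using integral_minus_mean_value[OF c\<mu>[OF k] domain] by simp
  qed
  \<comment> \<open>The mean-free Caputo sums are a lower triangular homogeneous system for the
    integrals of the increments, with positive diagonal, solved by strong induction.\<close>
  have mass: "integral (cbox a b) (w k) = 0" if "1 \<le> k" "k \<le> N" for k
    using that
  proof (induction k rule: less_induct)
    case (less k)
    define m where "m = k - 1"
    have m: "k = m + 1" "m < N" using less.prems by (auto simp: m_def)
    have "0 = integral (cbox a b) (\<lambda>x. \<Sum>j=1..m+1. kernel_b t (1 - \<alpha>) (m + 1) (m + 1 - j) * w j x)"
      using cap0[OF m(2)] by (simp add: caputo_L1plus_def[abs_def] w_def)
    also have "\<dots> = (\<Sum>j=1..m+1. kernel_b t (1 - \<alpha>) (m + 1) (m + 1 - j) * integral (cbox a b) (w j))"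
      using m by (subst integral_sum) (auto intro!: integrable_on_cbox_continuous continuous_intros cw)
    also have "\<dots> = kernel_b t (1 - \<alpha>) (m + 1) 0 * integral (cbox a b) (w (m + 1))"
    proof -
      have "(\<Sum>j=1..m. kernel_b t (1 - \<alpha>) (m + 1) (m + 1 - j) * integral (cbox a b) (w j)) = 0"
        using less m by (intro sum.neutral) auto
      then show ?thesis by simp
    qed
    finally show ?case
      using kernel_b_0_pos[of "1 - \<alpha>" "m + 1" t] alpha mono m by (auto simp: m(1))
  qed
  have "relaxed_energy (box a b) \<epsilon> S (\<phi> (n + 1)) (r (n + 1)) - relaxed_energy (box a b) \<epsilon> S (\<phi> n) (r n)
      = integral (cbox a b) (\<lambda>x. \<mu> n x * (\<phi> (n + 1) x - \<phi> n x))"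
  proof (rule relaxed_energy_step)
    fix x assume "x \<in> box a b"
    then show "\<mu> n x = - \<epsilon>\<^sup>2 * laplacian (\<lambda>x. (\<phi> (n + 1) x + \<phi> n x) / 2) x
         + (r (n + 1) x + S) * ((\<phi> (n + 1) x + \<phi> n x) / 2)"
      "(r (n + 1) x + r n x) / 2 = (\<phi> n x)\<^sup>2 - 1 - S"
      using sch n by (auto simp: avg_half_def)
  qed (use n \<phi> domain in auto)
  also have "\<dots> = integral (cbox a b) (\<lambda>x. mean_value (box a b) (\<mu> n) * w (n + 1) x
      - (1 / M) * (w (n + 1) x * caputo_L1plus t \<alpha> \<phi> n x))"
  proof (rule integral_cbox_cong_box)
    fix x assume "x \<in> box a b"
    then show "\<mu> n x * (\<phi> (n + 1) x - \<phi> n x) =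
        mean_value (box a b) (\<mu> n) * w (n + 1) x - (1 / M) * (w (n + 1) x * caputo_L1plus t \<alpha> \<phi> n x)"
      unfolding caputo[OF n \<open>x \<in> box a b\<close>] w_def backward_diff_def using M by (simp add: field_simps)
  qed
  also have "\<dots> = mean_value (box a b) (\<mu> n) * integral (cbox a b) (w (n + 1))
      - (1 / M) * integral (cbox a b) (\<lambda>x. w (n + 1) x * caputo_L1plus t \<alpha> \<phi> n x)"
    using n M by (subst integral_diff) (auto intro!: integrable_on_cbox_continuous continuous_intros cw ccap)
  also have "\<dots> = - (1 / M) * integral (cbox a b) (\<lambda>x. w (n + 1) x * caputo_L1plus t \<alpha> \<phi> n x)"
    using mass[of "n + 1"] n by simp
  finally show ?thesis by (simp add: w_def)
qed

text \<open>With \<open>g = \<phi>^2 - 1\<close> and \<open>r = g - S\<close> the potential part is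
  \<open>g (g - S)/2 - (g - S)^2/4 + S^2/4 = g^2/4\<close>, which explains the additive constant in
  \<open>relaxed_energy\<close>.\<close>

lemma relaxed_energy_initial:
  assumes "\<And>x. x \<in> box a b \<Longrightarrow> r x = (\<phi> x)\<^sup>2 - 1 - S" and \<phi>: "C_diff 2 \<phi>" and r: "continuous_on UNIV r"
  shows "relaxed_energy (box a b) \<epsilon> S \<phi> r = energy (box a b) \<epsilon> \<phi>"
proof -
  have d: "\<And>x. \<phi> differentiable (at x)" "\<And>i x. i \<in> Basis \<Longrightarrow> partial_deriv i \<phi> differentiable (at x)"
    using \<phi> by (auto simp: C_diff_2_iff)
  note c = d[THEN differentiable_imp_continuous_on_UNIV]
  have "(norm (grad \<phi> x))\<^sup>2 = (\<Sum>i\<in>Basis. partial_deriv i \<phi> x * partial_deriv i \<phi> x)" for x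
    unfolding dot_square_norm[symmetric] grad_inner_grad ..
  then have cg: "continuous_on UNIV (\<lambda>x. (norm (grad \<phi> x))\<^sup>2)"
    by (simp only:) (intro continuous_intros c)
  let ?f = "\<lambda>x. \<epsilon>\<^sup>2 / 2 * (norm (grad \<phi> x))\<^sup>2 + 1/2 * (r x + S) * ((\<phi> x)\<^sup>2 - 1 - S) - 1/4 * (r x)\<^sup>2"
  have "relaxed_energy (box a b) \<epsilon> S \<phi> r = integral (cbox a b) ?f + integral (cbox a b) (\<lambda>x. S\<^sup>2 / 4)"
    unfolding relaxed_energy_def
    by (subst LINT_box_eq_integral) (auto intro!: continuous_intros cg c r simp: measure_lborel_box_eq measure_lborel_cbox_eq)
  also have "\<dots> = integral (cbox a b) (\<lambda>x. ?f x + S\<^sup>2 / 4)"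
    by (intro integral_add[symmetric] integrable_on_cbox_continuous continuous_intros cg c r)
  also have "\<dots> = integral (cbox a b) (\<lambda>x. \<epsilon>\<^sup>2 / 2 * (norm (grad \<phi> x))\<^sup>2 + 1/4 * ((\<phi> x)\<^sup>2 - 1)\<^sup>2)"
  proof (rule integral_cbox_cong_box)
    fix x assume "x \<in> box a b"
    then show "?f x + S\<^sup>2 / 4 = \<epsilon>\<^sup>2 / 2 * (norm (grad \<phi> x))\<^sup>2 + 1/4 * ((\<phi> x)\<^sup>2 - 1)\<^sup>2"
      unfolding assms(1)[OF \<open>x \<in> box a b\<close>] by (simp add: power2_eq_square field_simps)
  qed
  also have "\<dots> = energy (box a b) \<epsilon> \<phi>"
    unfolding energy_def
    by (intro LINT_box_eq_integral[symmetric] continuous_intros cg c)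
  finally show ?thesis .
qed

theorem theorem3p2:
  fixes a b :: "'a::euclidean_space"
    and \<alpha> M \<epsilon> S T :: real
    and t :: "nat \<Rightarrow> real" and N :: nat
    and \<phi> r \<mu> :: "nat \<Rightarrow> 'a \<Rightarrow> real"
  assumes domain: "box a b \<noteq> {}"
    and alpha: "0 < \<alpha>" "\<alpha> < 1"
    and params: "M > 0" "\<epsilon> > 0"
    and grid: "N \<ge> 1" "t 0 = 0" "t N = T" "\<And>k. k < N \<Longrightarrow> t k < t (k + 1)"
    and scheme: "L1plus_CN_relaxation a b \<alpha> M \<epsilon> S t N \<phi> r \<mu>"
  shows
    "(\<forall>n<N. relaxed_energy (box a b) \<epsilon> S (\<phi> (n + 1)) (r (n + 1))
              \<le> relaxed_energy (box a b) \<epsilon> S (\<phi> 0) (r 0)) \<and>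
     relaxed_energy (box a b) \<epsilon> S (\<phi> 0) (r 0) = energy (box a b) \<epsilon> (\<phi> 0) \<and>
     ((\<forall>k. 2 \<le> k \<and> k + 1 \<le> N \<longrightarrow>
          step_ratio t (k + 1) \<ge> H_fun (1 - \<alpha>) (step_ratio t k)) \<longrightarrow>
      (\<forall>n. 2 \<le> n \<and> n \<le> N - 1 \<longrightarrow>
          modified_energy (box a b) \<alpha> M \<epsilon> S t \<phi> r (n + 1)
            - modified_energy (box a b) \<alpha> M \<epsilon> S t \<phi> r n
            = - (1 / M) * R_fun (box a b) t (1 - \<alpha>) (backward_diff \<phi>) (n + 1) \<and>
          - (1 / M) * R_fun (box a b) t (1 - \<alpha>) (backward_diff \<phi>) (n + 1) \<le> 0))"
proof (intro conjI allI impI)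
  have mono: "t i < t j" if "i < j" "j \<le> N" for i j
    using strict_mono_upto[of N t i j] grid(4) that by blast
  have \<beta>: "0 < 1 - \<alpha>" "1 - \<alpha> < 1" using alpha by auto
  note sch = scheme[unfolded L1plus_CN_relaxation_def]
  have step: "relaxed_energy (box a b) \<epsilon> S (\<phi> (n + 1)) (r (n + 1)) - relaxed_energy (box a b) \<epsilon> S (\<phi> n) (r n)
      = - (1 / M) * integral (cbox a b) (\<lambda>x. backward_diff \<phi> (n + 1) x * caputo_L1plus t \<alpha> \<phi> n x)"
    if "n < N" for n
    by (rule scheme_energy_step[OF domain alpha params(1) _ scheme that]) (rule mono)
  define w where "w = backward_diff \<phi>"
  have c\<phi>: "continuous_on UNIV (\<phi> k)" if "k \<le> N" for k
    using sch that by (intro differentiable_imp_continuous_on_UNIV) (simp add: C_diff_2_iff)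
  have cw: "continuous_on UNIV (w k)" if "k \<le> N" for k
    unfolding w_def backward_diff_def using that by (intro continuous_intros c\<phi>) auto
  {
    fix n assume n: "n < N"
    let ?E = "\<lambda>n. relaxed_energy (box a b) \<epsilon> S (\<phi> n) (r n)"
    let ?f = "\<lambda>m x. w m x * (\<Sum>k=1..m. kernel_b t (1 - \<alpha>) m (m - k) * w k x)"
    \<comment> \<open>The increments telescope, and all pairings are kept under one integral so that
      positivity can be used at each point.\<close>
    have "?E m - ?E 0 = - (1 / M) * integral (cbox a b) (\<lambda>x. \<Sum>k=1..m. ?f k x)" if "m \<le> N" for m
      using that
    proof (induction m)
      case (Suc m)
      have c: "continuous_on UNIV (?f k)" if "k \<le> Suc m" for k
        using that Suc.prems by (intro continuous_intros cw) auto
      have "integral (cbox a b) (\<lambda>x. \<Sum>k=1..Suc m. ?f k x) =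
          integral (cbox a b) (\<lambda>x. (\<Sum>k=1..m. ?f k x) + ?f (Suc m) x)" by simp
      also have "\<dots> = integral (cbox a b) (\<lambda>x. \<Sum>k=1..m. ?f k x) + integral (cbox a b) (?f (Suc m))"
        by (intro integral_add integrable_on_cbox_continuous continuous_on_sum c) auto
      moreover have "?E (Suc m) - ?E m = - (1 / M) * integral (cbox a b) (?f (Suc m))"
        using step[of m] Suc.prems by (simp add: w_def caputo_L1plus_def)
      ultimately show ?case using Suc by (simp add: algebra_simps)
    qed simp
    from this[of "n + 1"] n
    have "?E (n + 1) - ?E 0 = - ((1 / M) * integral (cbox a b) (\<lambda>x. \<Sum>k=1..n+1. ?f k x))"
      by simp
    \<comment> \<open>At fixed \<open>x\<close> the integrand is the kernel form in the real numbers
      \<open>w k x\<close>.\<close>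
    moreover have "0 \<le> integral (cbox a b) (\<lambda>x. \<Sum>k=1..n+1. ?f k x)"
      using n by (intro integral_nonneg integrable_on_cbox_continuous continuous_intros cw
          kernel_b_sum_nonneg \<beta> mono) auto
    then have "0 \<le> (1 / M) * integral (cbox a b) (\<lambda>x. \<Sum>k=1..n+1. ?f k x)"
      using params(1) by (intro mult_nonneg_nonneg) auto
    ultimately show "?E (n + 1) \<le> ?E 0" by linarith
  }
  show "relaxed_energy (box a b) \<epsilon> S (\<phi> 0) (r 0) = energy (box a b) \<epsilon> (\<phi> 0)"
    using sch by (intro relaxed_energy_initial) auto
  fix n
  assume ratio: "\<forall>k. 2 \<le> k \<and> k + 1 \<le> N \<longrightarrow> step_ratio t (k + 1) \<ge> H_fun (1 - \<alpha>) (step_ratio t k)"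
    and n: "2 \<le> n \<and> n \<le> N - 1"
  then have nN: "n < N" "n + 1 \<le> N" using grid(1) by auto
  have "integral (cbox a b) (\<lambda>x. backward_diff \<phi> (n + 1) x * caputo_L1plus t \<alpha> \<phi> n x) =
      A_fun (box a b) t (1 - \<alpha>) (backward_diff \<phi>) (n + 1) - A_fun (box a b) t (1 - \<alpha>) (backward_diff \<phi>) n
      + R_fun (box a b) t (1 - \<alpha>) (backward_diff \<phi>) (n + 1)"
    using n nN by (intro integral_backward_diff_caputo c\<phi>) auto
  then show "modified_energy (box a b) \<alpha> M \<epsilon> S t \<phi> r (n + 1) - modified_energy (box a b) \<alpha> M \<epsilon> S t \<phi> r n
      = - (1 / M) * R_fun (box a b) t (1 - \<alpha>) (backward_diff \<phi>) (n + 1)"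
    using step[OF nN(1)] by (simp add: modified_energy_def diff_divide_distrib add_divide_distrib)
  \<comment> \<open>For the passage from \<open>n\<close> to \<open>n + 1\<close> the ratio
    condition enters at \<open>k = n\<close>.\<close>
  have "0 \<le> R_fun (box a b) t (1 - \<alpha>) (backward_diff \<phi>) (n + 1)"
    using n nN ratio by (intro R_fun_nonneg \<beta> mono) auto
  then show "- (1 / M) * R_fun (box a b) t (1 - \<alpha>) (backward_diff \<phi>) (n + 1) \<le> 0"
    using params by simp
qed

end
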